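(* Let $\alpha\in(0,1)$ and $k\ge1$. Let $f\in L^2(\Omega)$ and $f_h=\pi_hf$. Let $u_h=\mathbb{A}^{-\alpha}f_h\in V_h$ be the finite element semi-discrete approximation, and let $w_h=\lambda_1^{-\alpha}r_{\alpha,k}(\lambda_1\mathbb{A}^{-1})f_h\in V_h$ be the fully discrete approximation, where $\lambda_1$ is the smallest eigenvalue of $\mathbb{A}$. Then $$\|u_h-w_h\|\le\lambda_1^{-\alpha}E_{\alpha,k}\,\|f_h\| .$$
   Context: $\Omega\subset\mathbb{R}^d$ is a bounded domain, $(\cdot,\cdot)$ and $\|\cdot\|$ are the inner product and norm of $L^2(\Omega)$, $a$ is a measurable coefficient, bounded above, with $0<a_0\le a(x)$ on $\Omega$, and $a(w,\theta)=\int_\Omega a(x)\nabla w\cdot\nabla\theta\,dx$ on $H^1_0(\Omega)$. $V_h\subset H^1_0(\Omega)$ is the finite dimensional space of continuous piecewise linear functions (vanishing on $\partial\Omega$) over a quasi-uniform partition of $\Omega$ into $d$-simplices, and $\pi_h$ is the $L^2(\Omega)$-orthogonal projection onto $V_h$. The operator $\mathbb{A}:V_h\to V_h$ is defined by $(\mathbb{A}v_h,\theta_h)=a(v_h,\theta_h)$ for all $v_h,\theta_h\in V_h$ (consistent mass, no lumping); it is symmetric positive definite on $(V_h,(\cdot,\cdot))$, and functions of $\mathbb{A}$ (including $\mathbb{A}^{-\alpha}$ and $r_{\alpha,k}(\lambda_1\mathbb{A}^{-1})$) are defined through its eigen-decomposition. $\mathcal{R}_k$ denotes the set of rational functions $P(t)/Q(t)$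 with $P,Q$ real polynomials of degree at most $k$ and $Q(0)=1$; $r_{\alpha,k}\in\mathcal{R}_k$ is the best uniform rational approximation of $t^\alpha$ on $[0,1]$, i.e. the minimizer of $\|s(t)-t^\alpha\|_{L^\infty[0,1]}$ over $s\in\mathcal{R}_k$, and $E_{\alpha,k}=\|r_{\alpha,k}(t)-t^\alpha\|_{L^\infty[0,1]}$. *)

theory Defs
  imports
    "HOL-Probability.Essential_Supremum"
    "HOL-Computational_Algebra.Computational_Algebra"
begin

subsection \<open>The spaces \<open>L\<^sup>2(\<Omega>)\<close> and \<open>H\<^sup>1\<^sub>0(\<Omega>)\<close>\<close>

text \<open>Functions on \<open>\<Omega>\<close> are total functions of which only the values on \<open>\<Omega>\<close> matter; elements of
  \<open>L\<^sup>2\<close> are not identified when they agree almost everywhere.\<close>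

definition L2 :: "'a::euclidean_space set \<Rightarrow> ('a \<Rightarrow> 'b::euclidean_space) set" where
  "L2 \<Omega> = {f. f \<in> borel_measurable (lebesgue_on \<Omega>) \<and>
               integrable (lebesgue_on \<Omega>) (\<lambda>x. (norm (f x))\<^sup>2)}"

definition L2_inner ::
  "'a::euclidean_space set \<Rightarrow> ('a \<Rightarrow> 'b::euclidean_space) \<Rightarrow> ('a \<Rightarrow> 'b) \<Rightarrow> real" where
  "L2_inner \<Omega> f g = (LINT x|lebesgue_on \<Omega>. f x \<bullet> g x)"

definition L2_norm :: "'a::euclidean_space set \<Rightarrow> ('a \<Rightarrow> 'b::euclidean_space) \<Rightarrow> real" where
  "L2_norm \<Omega> f = sqrt (L2_inner \<Omega> f f)"

definition partial_deriv :: "'a::euclidean_space \<Rightarrow> ('a \<Rightarrow> real) \<Rightarrow> 'a \<Rightarrow> real" where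
  "partial_deriv b \<phi> x = frechet_derivative \<phi> (at x) b"

primrec Ck :: "nat \<Rightarrow> ('a::euclidean_space \<Rightarrow> real) \<Rightarrow> bool" where
  "Ck 0 \<phi> \<longleftrightarrow> continuous_on UNIV \<phi>"
| "Ck (Suc n) \<phi> \<longleftrightarrow>
     (\<forall>x. \<phi> differentiable (at x)) \<and> (\<forall>b\<in>Basis. Ck n (partial_deriv b \<phi>))"

definition test_functions :: "'a::euclidean_space set \<Rightarrow> ('a \<Rightarrow> real) set" where
  "test_functions \<Omega> = {\<phi>. (\<forall>n. Ck n \<phi>) \<and>
     compact (closure {x. \<phi> x \<noteq> 0}) \<and> closure {x. \<phi> x \<noteq> 0} \<subseteq> \<Omega>}"

definition grad :: "('a::euclidean_space \<Rightarrow> real) \<Rightarrow> 'a \<Rightarrow> 'a" where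
  "grad \<phi> x = (\<Sum>b\<in>Basis. partial_deriv b \<phi> x *\<^sub>R b)"

definition is_weak_grad ::
  "'a::euclidean_space set \<Rightarrow> ('a \<Rightarrow> real) \<Rightarrow> ('a \<Rightarrow> 'a) \<Rightarrow> bool" where
  "is_weak_grad \<Omega> w g \<longleftrightarrow> g \<in> L2 \<Omega> \<and>
     (\<forall>\<phi>\<in>test_functions \<Omega>. \<forall>b\<in>Basis.
        (LINT x|lebesgue_on \<Omega>. w x * partial_deriv b \<phi> x)
          = - (LINT x|lebesgue_on \<Omega>. (g x \<bullet> b) * \<phi> x))"

text \<open>The weak gradient is unique up to a null set; some representative is chosen.\<close>

definition weak_grad :: "'a::euclidean_space set \<Rightarrow> ('a \<Rightarrow> real) \<Rightarrow> 'a \<Rightarrow> 'a" where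
  "weak_grad \<Omega> w = (SOME g. is_weak_grad \<Omega> w g)"

text \<open>\<open>H\<^sup>1\<^sub>0(\<Omega>)\<close> is the closure of the test functions in \<open>H\<^sup>1(\<Omega>)\<close>.\<close>

definition H10 :: "'a::euclidean_space set \<Rightarrow> ('a \<Rightarrow> real) set" where
  "H10 \<Omega> = {w \<in> L2 \<Omega>. \<exists>g. is_weak_grad \<Omega> w g \<and>
     (\<exists>\<phi> :: nat \<Rightarrow> 'a \<Rightarrow> real. (\<forall>n. \<phi> n \<in> test_functions \<Omega>) \<and>
        (\<lambda>n. L2_norm \<Omega> (\<lambda>x. \<phi> n x - w x)) \<longlonglongrightarrow> 0 \<and>
        (\<lambda>n. L2_norm \<Omega> (\<lambda>x. grad (\<phi> n) x - g x)) \<longlonglongrightarrow> 0)}"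

definition energy_form ::
  "'a::euclidean_space set \<Rightarrow> ('a \<Rightarrow> real) \<Rightarrow> ('a \<Rightarrow> real) \<Rightarrow> ('a \<Rightarrow> real) \<Rightarrow> real" where
  "energy_form \<Omega> a w \<theta> =
     (LINT x|lebesgue_on \<Omega>. a x * (weak_grad \<Omega> w x \<bullet> weak_grad \<Omega> \<theta> x))"

text \<open>\<open>L\<^sup>2(\<Omega>)\<close>-orthogonal projection onto a subspace \<open>W\<close>. It is applied only to subspaces of the
  finite element space below, whose elements are determined by their \<open>L\<^sup>2(\<Omega>)\<close>-class.\<close>

definition L2_proj :: "'a::euclidean_space set \<Rightarrow> ('a \<Rightarrow> real) set \<Rightarrow> ('a \<Rightarrow> real) \<Rightarrow> 'a \<Rightarrow> real" where
  "L2_proj \<Omega> W f = (THE p. p \<in> W \<and> (\<forall>v\<in>W. L2_inner \<Omega> (\<lambda>x. f x - p x) v = 0))"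

subsection \<open>The finite element space\<close>

definition mesh_size :: "'a::euclidean_space set set \<Rightarrow> real" where
  "mesh_size \<T> = Max (diameter ` \<T>)"

text \<open>Quasi-uniformity of a family of partitions means that every member satisfies the following
  with one and the same \<open>\<sigma>\<close>.\<close>

definition quasi_uniform_partition ::
  "real \<Rightarrow> 'a::euclidean_space set \<Rightarrow> 'a set set \<Rightarrow> bool" where
  "quasi_uniform_partition \<sigma> \<Omega> \<T> \<longleftrightarrow>
     triangulation \<T> \<and> (\<forall>K\<in>\<T>. int DIM('a) simplex K) \<and> \<Union>\<T> = closure \<Omega> \<and>
     (\<forall>K\<in>\<T>. \<exists>x. cball x (\<sigma> * mesh_size \<T>) \<subseteq> K)"

text \<open>Elements are extended by \<open>0\<close> outside \<open>\<Omega>\<close>, in particular on the boundary, so that each is a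
  uniquely determined function.\<close>

definition fe_space :: "'a::euclidean_space set \<Rightarrow> 'a set set \<Rightarrow> ('a \<Rightarrow> real) set" where
  "fe_space \<Omega> \<T> = {v \<in> H10 \<Omega>.
     continuous_on (closure \<Omega>) v \<and>
     (\<forall>K\<in>\<T>. \<exists>p c. \<forall>x\<in>K. v x = p \<bullet> x + c) \<and>
     (\<forall>x. x \<notin> \<Omega> \<longrightarrow> v x = 0)}"

text \<open>\<open>A\<close> is the operator \<open>V \<rightarrow> V\<close> with \<open>(A v, \<theta>) = a(v, \<theta>)\<close>; its values off \<open>V\<close> are irrelevant.\<close>

definition is_discrete_operator ::
  "'a::euclidean_space set \<Rightarrow> ('a \<Rightarrow> real) \<Rightarrow> ('a \<Rightarrow> real) set \<Rightarrow>
   (('a \<Rightarrow> real) \<Rightarrow> ('a \<Rightarrow> real)) \<Rightarrow> bool" where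
  "is_discrete_operator \<Omega> a V A \<longleftrightarrow>
     (\<forall>v\<in>V. A v \<in> V \<and> (\<forall>\<theta>\<in>V. L2_inner \<Omega> (A v) \<theta> = energy_form \<Omega> a v \<theta>))"

subsection \<open>Functions of an operator through its eigen-decomposition\<close>

definition eigenspace ::
  "('a \<Rightarrow> real) set \<Rightarrow> (('a \<Rightarrow> real) \<Rightarrow> ('a \<Rightarrow> real)) \<Rightarrow> real \<Rightarrow> ('a \<Rightarrow> real) set" where
  "eigenspace V A \<mu> = {v \<in> V. A v = (\<lambda>x. \<mu> * v x)}"

definition eigenvalues ::
  "('a \<Rightarrow> real) set \<Rightarrow> (('a \<Rightarrow> real) \<Rightarrow> ('a \<Rightarrow> real)) \<Rightarrow> real set" where
  "eigenvalues V A = {\<mu>. \<exists>v\<in>eigenspace V A \<mu>. v \<noteq> (\<lambda>x. 0)}"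

definition smallest_eigenvalue ::
  "('a \<Rightarrow> real) set \<Rightarrow> (('a \<Rightarrow> real) \<Rightarrow> ('a \<Rightarrow> real)) \<Rightarrow> real" where
  "smallest_eigenvalue V A = Min (eigenvalues V A)"

text \<open>\<open>F(A) v = \<Sum>\<^sub>\<mu> F(\<mu>) P\<^sub>\<mu> v\<close>, where \<open>P\<^sub>\<mu>\<close> is the orthogonal projection onto the eigenspace of \<open>\<mu>\<close>;
  grouping by eigenspaces makes the choice of an orthonormal eigenbasis unnecessary.\<close>

definition operator_fun ::
  "'a::euclidean_space set \<Rightarrow> ('a \<Rightarrow> real) set \<Rightarrow> (('a \<Rightarrow> real) \<Rightarrow> ('a \<Rightarrow> real)) \<Rightarrow>
   (real \<Rightarrow> real) \<Rightarrow> ('a \<Rightarrow> real) \<Rightarrow> 'a \<Rightarrow> real" where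
  "operator_fun \<Omega> V A F v =
     (\<lambda>x. \<Sum>\<mu>\<in>eigenvalues V A. F \<mu> * L2_proj \<Omega> (eigenspace V A \<mu>) v x)"

subsection \<open>Best uniform rational approximation\<close>

text \<open>A rational function is evaluated in lowest terms, so that \<open>poly P t / poly Q t\<close> takes the
  convention \<open>x / 0 = 0\<close> only at genuine poles, never at removable singularities. Cancelling
  common factors keeps the degree bounds and, after rescaling, \<open>Q(0) = 1\<close>.\<close>

definition rational_functions :: "nat \<Rightarrow> (real \<Rightarrow> real) set" where
  "rational_functions k = {\<lambda>t. poly P t / poly Q t | P Q :: real poly.
     degree P \<le> k \<and> degree Q \<le> k \<and> poly Q 0 = 1 \<and> coprime P Q}"

text \<open>The \<open>L\<^sup>\<infinity>[0,1]\<close>-norm of \<open>s(t) - t\<^sup>\<alpha>\<close>; it is \<open>\<infinity>\<close> if \<open>s\<close> has a pole in \<open>[0,1]\<close>.\<close>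

definition approx_error :: "real \<Rightarrow> (real \<Rightarrow> real) \<Rightarrow> ereal" where
  "approx_error \<alpha> s = esssup (lebesgue_on {0..1}) (\<lambda>t. ereal \<bar>s t - t powr \<alpha>\<bar>)"

definition is_best_rational_approx :: "real \<Rightarrow> nat \<Rightarrow> (real \<Rightarrow> real) \<Rightarrow> bool" where
  "is_best_rational_approx \<alpha> k r \<longleftrightarrow> r \<in> rational_functions k \<and>
     (\<forall>s\<in>rational_functions k. approx_error \<alpha> r \<le> approx_error \<alpha> s)"

end

theory Submission
  imports Defs
begin

text \<open>
  Put \<open>t = \<lambda>\<^sub>1 / \<mu>\<close>. As \<open>\<mu>\<^sup>-\<^sup>\<alpha> = \<lambda>\<^sub>1\<^sup>-\<^sup>\<alpha> t\<^sup>\<alpha>\<close>, the error \<open>u\<^sub>h - w\<^sub>h\<close> is \<open>F(A) f\<^sub>h\<close> with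
  \<open>F(\<mu>) = \<lambda>\<^sub>1\<^sup>-\<^sup>\<alpha> (t\<^sup>\<alpha> - r(t))\<close>. On the spectrum \<open>0 < \<lambda>\<^sub>1 \<le> \<mu>\<close>, so \<open>t\<close> lies in \<open>[0,1]\<close>, where the
  approximation error is at most \<open>E\<close>; hence \<open>\<bar>F\<bar> \<le> \<lambda>\<^sub>1\<^sup>-\<^sup>\<alpha> E\<close> on the spectrum. Since eigenspaces
  of different eigenvalues are orthogonal, Pythagoras and Bessel's inequality turn this into the
  norm bound (\<open>operator_fun_norm_le\<close>). Four points need an argument.

  \<^item> The spectral calculus. Values at the vertices of the mesh determine a finite element
  function, which bounds the size of orthonormal families; so orthogonal projections exist and the
  spectrum is finite. The operator is symmetric because the energy form is. Its linearity is
  deduced from symmetry and definiteness, because the weak gradient of a sum, being a chosen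
  representative, has no evident relation to those of the summands.

  \<^item> Positivity of the eigenvalues. An eigenvector of a nonpositive eigenvalue would have a weak
  gradient that vanishes almost everywhere. The functions of \<open>H\<^sup>1\<^sub>0(\<Omega>)\<close> with this property are zero
  almost everywhere (\<open>H10_weak_grad_zero\<close>); test functions with the weight \<open>x \<bullet> b\<close> do here what
  Poincare's inequality usually does.

  \<^item> Definiteness. A finite element function is continuous on \<open>\<Omega>\<close> and vanishes off \<open>\<Omega>\<close>, so it is
  zero as soon as its \<open>L\<^sup>2\<close>-norm is.

  \<^item> The approximation error at single points. \<open>E\<close> is an essential supremum, but the spectrum
  is a finite set. Multiplying \<open>\<bar>P/Q - t\<^sup>\<alpha>\<bar> \<le> E\<close> by \<open>\<bar>Q\<bar>\<close> gives an inequality between continuous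
  functions, which extends from almost every \<open>t\<close> to all \<open>t\<close>; it also excludes zeros of \<open>Q\<close>
  in \<open>[0,1]\<close> because \<open>P\<close> and \<open>Q\<close> are coprime (\<open>best_approx_pointwise\<close>).
\<close>

section \<open>The inner product of L2\<close>

lemma L2_dest:
  assumes "f \<in> L2 \<Omega>"
  shows "f \<in> borel_measurable (lebesgue_on \<Omega>)" "integrable (lebesgue_on \<Omega>) (\<lambda>x. (norm (f x))\<^sup>2)"
  using assms by (auto simp: L2_def)

lemma L2_inner_integrable:
  assumes "f \<in> L2 \<Omega>" and "g \<in> L2 \<Omega>"
  shows "integrable (lebesgue_on \<Omega>) (\<lambda>x. f x \<bullet> g x)"
proof (rule Bochner_Integration.integrable_bound)
  show "integrable (lebesgue_on \<Omega>) (\<lambda>x. (norm (f x))\<^sup>2 + (norm (g x))\<^sup>2)"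
    using L2_dest(2)[OF assms(1)] L2_dest(2)[OF assms(2)] by simp
  show "(\<lambda>x. f x \<bullet> g x) \<in> borel_measurable (lebesgue_on \<Omega>)"
    using L2_dest(1)[OF assms(1)] L2_dest(1)[OF assms(2)] by simp
  have "\<bar>f x \<bullet> g x\<bar> \<le> (norm (f x))\<^sup>2 + (norm (g x))\<^sup>2" for x
  proof -
    have "\<bar>f x \<bullet> g x\<bar> \<le> norm (f x) * norm (g x)" by (rule Cauchy_Schwarz_ineq2)
    moreover have "2 * (norm (f x) * norm (g x)) \<le> (norm (f x))\<^sup>2 + (norm (g x))\<^sup>2"
      using sum_squares_bound[of "norm (f x)" "norm (g x)"] by simp
    moreover have "0 \<le> norm (f x) * norm (g x)" by simp
    ultimately show ?thesis by linarith
  qed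
  then show "AE x in lebesgue_on \<Omega>. norm (f x \<bullet> g x) \<le> norm ((norm (f x))\<^sup>2 + (norm (g x))\<^sup>2)"
    by simp
qed

lemma L2_scaleR:
  assumes "f \<in> L2 \<Omega>"
  shows "(\<lambda>x. c *\<^sub>R f x) \<in> L2 \<Omega>"
  using L2_dest[OF assms] by (simp add: L2_def power_mult_distrib)

lemma L2_cmult: "f \<in> L2 \<Omega> \<Longrightarrow> (\<lambda>x. c * f x :: real) \<in> L2 \<Omega>"
  using L2_scaleR[of f \<Omega> c] by simp

lemma L2_add:
  assumes "f \<in> L2 \<Omega>" and "g \<in> L2 \<Omega>"
  shows "(\<lambda>x. f x + g x) \<in> L2 \<Omega>"
proof -
  have "(\<lambda>x. (norm (f x + g x))\<^sup>2) =
      (\<lambda>x. (norm (f x))\<^sup>2 + 2 * (f x \<bullet> g x) + (norm (g x))\<^sup>2)"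
    by (auto simp: power2_norm_eq_inner inner_add_left inner_add_right inner_commute)
  moreover have "integrable (lebesgue_on \<Omega>)
      (\<lambda>x. (norm (f x))\<^sup>2 + 2 * (f x \<bullet> g x) + (norm (g x))\<^sup>2)"
    using L2_dest(2)[OF assms(1)] L2_dest(2)[OF assms(2)] L2_inner_integrable[OF assms] by simp
  ultimately show ?thesis
    using L2_dest(1)[OF assms(1)] L2_dest(1)[OF assms(2)] by (simp add: L2_def)
qed

lemma L2_zero: "(\<lambda>x. 0) \<in> L2 \<Omega>"
  by (simp add: L2_def)

lemma L2_diff:
  assumes "f \<in> L2 \<Omega>" and "g \<in> L2 \<Omega>"
  shows "(\<lambda>x. f x - g x) \<in> L2 \<Omega>"
  using L2_add[OF assms(1) L2_scaleR[OF assms(2), of "-1"]] by simp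

lemma L2_sum: "(\<And>i. i \<in> I \<Longrightarrow> f i \<in> L2 \<Omega>) \<Longrightarrow> (\<lambda>x. \<Sum>i\<in>I. f i x) \<in> L2 \<Omega>"
  by (induction I rule: infinite_finite_induct) (auto simp: L2_zero intro: L2_add)

lemma L2_scaleR_const:
  fixes u :: "'a::euclidean_space \<Rightarrow> real"
  assumes "u \<in> L2 \<Omega>"
  shows "(\<lambda>x. u x *\<^sub>R b) \<in> L2 \<Omega>"
  using L2_dest[OF assms] by (simp add: L2_def power_mult_distrib)

lemma L2_inner_component:
  fixes g :: "'a::euclidean_space \<Rightarrow> 'b::euclidean_space"
  assumes "g \<in> L2 \<Omega>" "norm b = 1"
  shows "(\<lambda>x. g x \<bullet> b) \<in> L2 \<Omega>"
proof -
  have "integrable (lebesgue_on \<Omega>) (\<lambda>x. (g x \<bullet> b)\<^sup>2)"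
  proof (rule Bochner_Integration.integrable_bound[OF L2_dest(2)[OF assms(1)]])
    show "(\<lambda>x. (g x \<bullet> b)\<^sup>2) \<in> borel_measurable (lebesgue_on \<Omega>)"
      using L2_dest(1)[OF assms(1)] by simp
    show "AE x in lebesgue_on \<Omega>. norm ((g x \<bullet> b)\<^sup>2) \<le> norm ((norm (g x))\<^sup>2)"
      using Cauchy_Schwarz_ineq[of "g _" b] assms(2)
      by (simp add: power2_norm_eq_inner[symmetric])
  qed
  then show ?thesis using L2_dest(1)[OF assms(1)] by (simp add: L2_def)
qed

lemma L2_mult_bounded:
  fixes u m :: "'a::euclidean_space \<Rightarrow> real"
  assumes u: "u \<in> L2 \<Omega>" and m: "m \<in> borel_measurable (lebesgue_on \<Omega>)"
    and B: "\<And>x. x \<in> \<Omega> \<Longrightarrow> \<bar>m x\<bar> \<le> B" and "\<Omega> \<in> sets lebesgue"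
  shows "(\<lambda>x. m x * u x) \<in> L2 \<Omega>"
proof -
  have "integrable (lebesgue_on \<Omega>) (\<lambda>x. (m x * u x)\<^sup>2)"
  proof (rule Bochner_Integration.integrable_bound)
    show "integrable (lebesgue_on \<Omega>) (\<lambda>x. B\<^sup>2 * (u x)\<^sup>2)"
      using L2_dest(2)[OF u] by simp
    show "(\<lambda>x. (m x * u x)\<^sup>2) \<in> borel_measurable (lebesgue_on \<Omega>)"
      using L2_dest(1)[OF u] m by simp
    have "(m x)\<^sup>2 \<le> B\<^sup>2" if "x \<in> \<Omega>" for x
      using B[OF that] by (metis abs_ge_zero power2_abs power_mono)
    then show "AE x in lebesgue_on \<Omega>. norm ((m x * u x)\<^sup>2) \<le> norm (B\<^sup>2 * (u x)\<^sup>2)"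
      by (intro AE_I2) (auto simp: power_mult_distrib mult_right_mono)
  qed
  then show ?thesis using L2_dest(1)[OF u] m by (simp add: L2_def)
qed

lemma L2_inner_commute: "L2_inner \<Omega> f g = L2_inner \<Omega> g f"
  by (simp add: L2_inner_def inner_commute)

lemma L2_inner_add:
  assumes "f \<in> L2 \<Omega>" "g \<in> L2 \<Omega>" "h \<in> L2 \<Omega>"
  shows "L2_inner \<Omega> (\<lambda>x. f x + g x) h = L2_inner \<Omega> f h + L2_inner \<Omega> g h"
  using L2_inner_integrable[OF assms(1,3)] L2_inner_integrable[OF assms(2,3)]
  by (simp add: L2_inner_def inner_add_left)

lemma L2_inner_diff:
  assumes "f \<in> L2 \<Omega>" "g \<in> L2 \<Omega>" "h \<in> L2 \<Omega>"
  shows "L2_inner \<Omega> (\<lambda>x. f x - g x) h = L2_inner \<Omega> f h - L2_inner \<Omega> g h"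
  using L2_inner_integrable[OF assms(1,3)] L2_inner_integrable[OF assms(2,3)]
  by (simp add: L2_inner_def inner_diff_left)

lemma L2_inner_cmult:
  fixes f g :: "'a::euclidean_space \<Rightarrow> real"
  shows "L2_inner \<Omega> (\<lambda>x. c * f x) g = c * L2_inner \<Omega> f g"
  by (simp add: L2_inner_def mult.assoc)

lemma L2_inner_zero: "L2_inner \<Omega> (\<lambda>x. 0) g = 0"
  by (simp add: L2_inner_def)

lemma L2_inner_sum:
  assumes "\<And>i. i \<in> I \<Longrightarrow> f i \<in> L2 \<Omega>" "h \<in> L2 \<Omega>"
  shows "L2_inner \<Omega> (\<lambda>x. \<Sum>i\<in>I. f i x) h = (\<Sum>i\<in>I. L2_inner \<Omega> (f i) h)"
  using assms(1)
proof (induction I rule: infinite_finite_induct)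
  case (insert i I)
  then show ?case
    using L2_inner_add[of "f i" \<Omega> "\<lambda>x. \<Sum>i\<in>I. f i x" h] assms(2) by (simp add: L2_sum)
qed (simp_all add: L2_inner_zero)

lemma L2_inner_nonneg: "0 \<le> L2_inner \<Omega> f f"
  by (simp add: L2_inner_def)

text \<open>Evaluated at suitable \<open>t\<close>, this yields the Cauchy-Schwarz, triangle and Bessel inequalities.\<close>

lemma L2_inner_quadratic:
  assumes f: "f \<in> L2 \<Omega>" and g: "g \<in> L2 \<Omega>"
  shows "L2_inner \<Omega> (\<lambda>x. f x + t *\<^sub>R g x) (\<lambda>x. f x + t *\<^sub>R g x) =
    L2_inner \<Omega> g g * t\<^sup>2 + (2 * L2_inner \<Omega> f g) * t + L2_inner \<Omega> f f"
proof -
  have "L2_inner \<Omega> (\<lambda>x. f x + t *\<^sub>R g x) (\<lambda>x. f x + t *\<^sub>R g x) =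
      (LINT x|lebesgue_on \<Omega>. f x \<bullet> f x + (2 * t) * (f x \<bullet> g x) + t\<^sup>2 * (g x \<bullet> g x))"
    unfolding L2_inner_def
    by (rule Bochner_Integration.integral_cong)
      (auto simp: inner_add_left inner_add_right inner_commute power2_eq_square algebra_simps)
  also have "\<dots> = L2_inner \<Omega> g g * t\<^sup>2 + (2 * L2_inner \<Omega> f g) * t + L2_inner \<Omega> f f"
    using L2_inner_integrable[OF f f] L2_inner_integrable[OF f g] L2_inner_integrable[OF g g]
    by (simp add: L2_inner_def)
  finally show ?thesis .
qed

lemma L2_Cauchy_Schwarz:
  assumes f: "f \<in> L2 \<Omega>" and g: "g \<in> L2 \<Omega>"
  shows "\<bar>L2_inner \<Omega> f g\<bar> \<le> L2_norm \<Omega> f * L2_norm \<Omega> g"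
proof -
  let ?a = "L2_inner \<Omega> f f" and ?b = "L2_inner \<Omega> f g" and ?c = "L2_inner \<Omega> g g"
  have q: "0 \<le> ?c * t\<^sup>2 + (2 * ?b) * t + ?a" for t
    unfolding L2_inner_quadratic[OF f g, symmetric] by (rule L2_inner_nonneg)
  have "?b\<^sup>2 \<le> ?a * ?c"
  proof (cases "?c = 0")
    case True
    have "?b = 0"
    proof (rule ccontr)
      assume "?b \<noteq> 0"
      then show False using q[of "- (?a + 1) / (2 * ?b)"] True by (simp add: field_simps)
    qed
    then show ?thesis using True by simp
  next
    case False
    then have c: "?c > 0" using L2_inner_nonneg[of \<Omega> g] by simp
    have "0 \<le> ?c * (?c * (- ?b / ?c)\<^sup>2 + (2 * ?b) * (- ?b / ?c) + ?a)"
      using q[of "- ?b / ?c"] c by simp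
    also have "\<dots> = ?a * ?c - ?b\<^sup>2"
      using c by (simp add: field_simps power2_eq_square)
    finally show ?thesis by simp
  qed
  then have "sqrt (?b\<^sup>2) \<le> sqrt (?a * ?c)" by (rule real_sqrt_le_mono)
  then show ?thesis by (simp add: L2_norm_def real_sqrt_mult)
qed

lemma L2_norm_nonneg: "0 \<le> L2_norm \<Omega> f"
  by (simp add: L2_norm_def L2_inner_nonneg)

lemma L2_norm_power2: "(L2_norm \<Omega> f)\<^sup>2 = L2_inner \<Omega> f f"
  by (simp add: L2_norm_def L2_inner_nonneg)

lemma L2_norm_add_scaleR_le:
  assumes f: "f \<in> L2 \<Omega>" and g: "g \<in> L2 \<Omega>"
  shows "L2_norm \<Omega> (\<lambda>x. f x + t *\<^sub>R g x) \<le> L2_norm \<Omega> f + \<bar>t\<bar> * L2_norm \<Omega> g"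
proof (rule power2_le_imp_le)
  have "L2_inner \<Omega> f g * t \<le> \<bar>t\<bar> * (L2_norm \<Omega> f * L2_norm \<Omega> g)"
  proof -
    have "L2_inner \<Omega> f g * t \<le> \<bar>t\<bar> * \<bar>L2_inner \<Omega> f g\<bar>"
      by (metis abs_ge_self abs_mult mult.commute)
    also have "\<dots> \<le> \<bar>t\<bar> * (L2_norm \<Omega> f * L2_norm \<Omega> g)"
      by (intro mult_left_mono L2_Cauchy_Schwarz f g) simp
    finally show ?thesis .
  qed
  then show "(L2_norm \<Omega> (\<lambda>x. f x + t *\<^sub>R g x))\<^sup>2 \<le> (L2_norm \<Omega> f + \<bar>t\<bar> * L2_norm \<Omega> g)\<^sup>2"
    unfolding power2_sum power_mult_distrib L2_norm_power2 L2_inner_quadratic[OF f g]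
    by (simp add: algebra_simps)
  show "0 \<le> L2_norm \<Omega> f + \<bar>t\<bar> * L2_norm \<Omega> g"
    by (simp add: L2_norm_nonneg)
qed

lemma L2_norm_lincomb_tendsto_0:
  assumes "\<And>n. f n \<in> L2 \<Omega>" "\<And>n. g n \<in> L2 \<Omega>"
    and "(\<lambda>n. L2_norm \<Omega> (f n)) \<longlonglongrightarrow> 0" "(\<lambda>n. L2_norm \<Omega> (g n)) \<longlonglongrightarrow> 0"
  shows "(\<lambda>n. L2_norm \<Omega> (\<lambda>x. f n x + c *\<^sub>R g n x)) \<longlonglongrightarrow> 0"
proof (rule tendsto_sandwich[OF _ _ tendsto_const])
  show "(\<lambda>n. L2_norm \<Omega> (f n) + \<bar>c\<bar> * L2_norm \<Omega> (g n)) \<longlonglongrightarrow> 0"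
    using tendsto_add[OF assms(3) tendsto_mult[OF tendsto_const assms(4)]] by simp
qed (auto intro!: always_eventually L2_norm_nonneg L2_norm_add_scaleR_le assms)

text \<open>By Cauchy-Schwarz, strong convergence implies weak convergence. The limits
in \<open>H10_weak_grad_zero\<close> are of this form.\<close>

lemma L2_inner_tendsto:
  assumes "\<And>n. \<phi> n \<in> L2 \<Omega>" "w \<in> L2 \<Omega>" "u \<in> L2 \<Omega>"
    and lim: "(\<lambda>n. L2_norm \<Omega> (\<lambda>x. \<phi> n x - w x)) \<longlonglongrightarrow> 0"
  shows "(\<lambda>n. L2_inner \<Omega> (\<phi> n) u) \<longlonglongrightarrow> L2_inner \<Omega> w u"
proof (rule Lim_transform_bound[THEN LIM_zero_cancel])
  show "(\<lambda>n. L2_norm \<Omega> (\<lambda>x. \<phi> n x - w x) * L2_norm \<Omega> u) \<longlonglongrightarrow> 0"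
    using tendsto_mult[OF lim tendsto_const] by simp
  have "\<bar>L2_inner \<Omega> (\<phi> n) u - L2_inner \<Omega> w u\<bar> \<le> L2_norm \<Omega> (\<lambda>x. \<phi> n x - w x) * L2_norm \<Omega> u" for n
    using L2_Cauchy_Schwarz[OF L2_diff[OF assms(1)[of n] assms(2)] assms(3)]
      L2_inner_diff[OF assms(1)[of n] assms(2,3)] by simp
  then show "\<forall>\<^sub>F n in sequentially. norm (L2_inner \<Omega> (\<phi> n) u - L2_inner \<Omega> w u)
      \<le> norm (L2_norm \<Omega> (\<lambda>x. \<phi> n x - w x) * L2_norm \<Omega> u)"
    by (intro always_eventually allI) (simp add: order_trans[OF _ abs_ge_self])
qed

lemma L2_inner_self_eq_0_iff:
  assumes "f \<in> L2 \<Omega>"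
  shows "L2_inner \<Omega> f f = 0 \<longleftrightarrow> (AE x in lebesgue_on \<Omega>. f x = 0)"
  using integral_nonneg_eq_0_iff_AE[OF L2_inner_integrable[OF assms assms]]
  by (simp add: L2_inner_def)

lemma L2_inner_normalized:
  fixes q :: "'a::euclidean_space \<Rightarrow> real"
  assumes "L2_norm \<Omega> q \<noteq> 0"
  shows "L2_inner \<Omega> (\<lambda>x. (1 / L2_norm \<Omega> q) * q x) (\<lambda>x. (1 / L2_norm \<Omega> q) * q x) = 1"
proof -
  let ?c = "1 / L2_norm \<Omega> q"
  have "L2_inner \<Omega> (\<lambda>x. ?c * q x) (\<lambda>x. ?c * q x) = ?c * L2_inner \<Omega> q (\<lambda>x. ?c * q x)"
    by (rule L2_inner_cmult)
  also have "L2_inner \<Omega> q (\<lambda>x. ?c * q x) = ?c * L2_inner \<Omega> q q"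
    by (subst L2_inner_commute) (rule L2_inner_cmult)
  also have "?c * (?c * L2_inner \<Omega> q q) = 1"
    using assms by (simp add: L2_norm_power2[symmetric] power2_eq_square)
  finally show ?thesis .
qed

section \<open>Test functions\<close>

lemma partial_derivI: "(\<phi> has_derivative \<phi>') (at x) \<Longrightarrow> partial_deriv b \<phi> x = \<phi>' b"
  by (simp add: partial_deriv_def frechet_derivative_at[symmetric])

lemma differentiable_has_derivative_partial:
  "\<phi> differentiable (at x) \<Longrightarrow> (\<phi> has_derivative (\<lambda>h. partial_deriv h \<phi> x)) (at x)"
  by (simp add: partial_deriv_def frechet_derivative_works[symmetric])

lemma partial_deriv_add:
  assumes "\<phi> differentiable (at x)" "\<psi> differentiable (at x)"
  shows "partial_deriv b (\<lambda>x. \<phi> x + \<psi> x) x = partial_deriv b \<phi> x + partial_deriv b \<psi> x"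
  by (intro partial_derivI has_derivative_add differentiable_has_derivative_partial assms)

lemma partial_deriv_cmult:
  assumes "\<phi> differentiable (at x)"
  shows "partial_deriv b (\<lambda>x. c * \<phi> x) x = c * partial_deriv b \<phi> x"
  by (intro partial_derivI has_derivative_mult_right differentiable_has_derivative_partial assms)

lemma has_derivative_inner_mult:
  assumes "\<phi> differentiable (at x)"
  shows "((\<lambda>x. (x \<bullet> b) * \<phi> x) has_derivative
     (\<lambda>h. (x \<bullet> b) * partial_deriv h \<phi> x + (h \<bullet> b) * \<phi> x)) (at x)"
  using has_derivative_mult[OF has_derivative_inner_left[OF has_derivative_ident]
      differentiable_has_derivative_partial[OF assms]] .

lemma Ck_Suc_imp: "Ck (Suc n) \<phi> \<Longrightarrow> Ck n \<phi>"
proof (induction n arbitrary: \<phi>)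
  case 0
  then show ?case
    by (auto intro!: continuous_at_imp_continuous_on differentiable_imp_continuous_within)
qed auto

lemma Ck_add: "Ck n \<phi> \<Longrightarrow> Ck n \<psi> \<Longrightarrow> Ck n (\<lambda>x. \<phi> x + \<psi> x)"
proof (induction n arbitrary: \<phi> \<psi>)
  case (Suc n)
  then have "partial_deriv b (\<lambda>x. \<phi> x + \<psi> x) = (\<lambda>x. partial_deriv b \<phi> x + partial_deriv b \<psi> x)" for b
    by (auto simp: partial_deriv_add)
  with Suc show ?case by auto
qed (auto intro: continuous_intros)

lemma Ck_cmult: "Ck n \<phi> \<Longrightarrow> Ck n (\<lambda>x. c * \<phi> x)"
proof (induction n arbitrary: \<phi>)
  case (Suc n)
  then have "partial_deriv b (\<lambda>x. c * \<phi> x) = (\<lambda>x. c * partial_deriv b \<phi> x)" for b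
    by (auto simp: partial_deriv_cmult)
  with Suc show ?case by auto
qed (auto intro: continuous_intros)

lemma Ck_inner_mult: "Ck n \<phi> \<Longrightarrow> Ck n (\<lambda>x. (x \<bullet> b) * \<phi> x)"
proof (induction n arbitrary: \<phi>)
  case (Suc n)
  have d: "\<phi> differentiable (at x)" for x using Suc.prems by simp
  have "partial_deriv c (\<lambda>x. (x \<bullet> b) * \<phi> x) = (\<lambda>x. (x \<bullet> b) * partial_deriv c \<phi> x + (c \<bullet> b) * \<phi> x)" for c
    by (intro ext partial_derivI has_derivative_inner_mult d)
  moreover have "(\<lambda>x. (x \<bullet> b) * \<phi> x) differentiable (at x)" for x
    using has_derivative_inner_mult[OF d] by (rule differentiableI)
  moreover have "Ck n (\<lambda>x. (x \<bullet> b) * partial_deriv c \<phi> x + (c \<bullet> b) * \<phi> x)" if "c \<in> Basis" for c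
    using Suc.prems that by (intro Ck_add Suc.IH Ck_cmult Ck_Suc_imp[OF Suc.prems]) auto
  ultimately show ?case by simp
qed (auto intro!: continuous_intros)

lemma test_functions_supportI:
  assumes "\<phi> \<in> test_functions \<Omega>" "\<And>n. Ck n \<psi>"
    and "{x. \<psi> x \<noteq> 0} \<subseteq> closure {x. \<phi> x \<noteq> 0}"
  shows "\<psi> \<in> test_functions \<Omega>"
proof -
  have "closure {x. \<psi> x \<noteq> 0} \<subseteq> closure {x. \<phi> x \<noteq> 0}"
    using assms(3) by (simp add: closure_minimal)
  then show ?thesis
    using assms(1,2) compact_Int_closed[of "closure {x. \<phi> x \<noteq> 0}" "closure {x. \<psi> x \<noteq> 0}"]
    by (auto simp: test_functions_def Int_absorb1)
qed

text \<open>A point off the closed support has a neighbourhood on which the function is constant, so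
differentiation does not enlarge the closed support.\<close>

lemma test_functions_partial_deriv:
  assumes \<phi>: "\<phi> \<in> test_functions \<Omega>" and b: "b \<in> Basis"
  shows "partial_deriv b \<phi> \<in> test_functions \<Omega>"
proof (rule test_functions_supportI[OF \<phi>])
  fix n
  have "Ck (Suc n) \<phi>" using \<phi> by (simp add: test_functions_def del: Ck.simps)
  with b show "Ck n (partial_deriv b \<phi>)" by simp
next
  have "partial_deriv b \<phi> x = 0" if "x \<notin> closure {x. \<phi> x \<noteq> 0}" for x
  proof -
    have "frechet_derivative (\<lambda>x. 0) (at x) = frechet_derivative \<phi> (at x)"
      using that closure_subset[of "{x. \<phi> x \<noteq> 0}"]
      by (intro frechet_derivative_transform_within_open[where X = "- closure {x. \<phi> x \<noteq> 0}"]) auto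
    then show ?thesis by (simp add: partial_deriv_def fun_eq_iff)
  qed
  then show "{x. partial_deriv b \<phi> x \<noteq> 0} \<subseteq> closure {x. \<phi> x \<noteq> 0}" by blast
qed

lemma test_functions_inner_mult:
  assumes \<phi>: "\<phi> \<in> test_functions \<Omega>"
  shows "(\<lambda>x. (x \<bullet> b) * \<phi> x) \<in> test_functions \<Omega>"
proof (rule test_functions_supportI[OF \<phi>])
  show "Ck n (\<lambda>x. (x \<bullet> b) * \<phi> x)" for n
    using \<phi> by (intro Ck_inner_mult) (simp add: test_functions_def)
  show "{x. (x \<bullet> b) * \<phi> x \<noteq> 0} \<subseteq> closure {x. \<phi> x \<noteq> 0}"
    using closure_subset[of "{x. \<phi> x \<noteq> 0}"] by auto
qed

lemma test_functions_zero: "(\<lambda>x. 0) \<in> test_functions \<Omega>"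
proof -
  have "Ck n (\<lambda>x::'a. 0)" for n
  proof (induction n)
    case (Suc n)
    have "partial_deriv b (\<lambda>x::'a. 0) = (\<lambda>x. 0)" for b
      by (simp add: partial_deriv_def fun_eq_iff)
    with Suc show ?case by simp
  qed simp
  then show ?thesis by (simp add: test_functions_def)
qed

lemma test_functions_lincomb:
  assumes "\<phi> \<in> test_functions \<Omega>" "\<psi> \<in> test_functions \<Omega>"
  shows "(\<lambda>x. \<phi> x + c * \<psi> x) \<in> test_functions \<Omega>"
proof -
  let ?K = "closure {x. \<phi> x \<noteq> 0} \<union> closure {x. \<psi> x \<noteq> 0}"
  let ?S = "closure {x. \<phi> x + c * \<psi> x \<noteq> 0}"
  have K: "compact ?K" "?K \<subseteq> \<Omega>" using assms by (auto simp: test_functions_def)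
  have "{x. \<phi> x + c * \<psi> x \<noteq> 0} \<subseteq> {x. \<phi> x \<noteq> 0} \<union> {x. \<psi> x \<noteq> 0}" by auto
  also have "\<dots> \<subseteq> ?K" by (intro Un_mono closure_subset)
  finally have sub: "?S \<subseteq> ?K" by (rule closure_minimal) auto
  then have "compact ?S" using K(1) compact_Int_closed[of ?K ?S] by (simp add: Int_absorb1)
  moreover have "Ck n (\<lambda>x. \<phi> x + c * \<psi> x)" for n
    using assms by (intro Ck_add Ck_cmult) (auto simp: test_functions_def)
  ultimately show ?thesis using sub K(2) by (auto simp: test_functions_def)
qed

lemma test_functions_L2:
  assumes \<phi>: "\<phi> \<in> test_functions \<Omega>" and "open \<Omega>" "bounded \<Omega>"
  shows "\<phi> \<in> L2 \<Omega>"
proof -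
  let ?S = "closure {x. \<phi> x \<noteq> 0}"
  have "Ck 0 \<phi>" and S: "compact ?S" using \<phi> unfolding test_functions_def by blast+
  then have cont: "continuous_on UNIV \<phi>" by simp
  have meas: "\<phi> \<in> borel_measurable (lebesgue_on \<Omega>)"
    using borel_measurable_continuous_onI[OF cont]
    by (intro measurable_restrict_space1 measurable_completion) simp
  have "bounded (\<phi> ` ?S)"
    using cont S by (meson compact_continuous_image compact_imp_bounded continuous_on_subset subset_UNIV)
  then obtain B where "\<And>x. x \<in> ?S \<Longrightarrow> \<bar>\<phi> x\<bar> \<le> B" by (auto simp: bounded_iff)
  moreover have "\<phi> x = 0" if "x \<notin> ?S" for x using that closure_subset[of "{x. \<phi> x \<noteq> 0}"] by auto
  ultimately have "\<bar>\<phi> x\<bar> \<le> max B 0" for x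
    by (metis abs_zero max.cobounded2 max.coboundedI1)
  then have "(\<phi> x)\<^sup>2 \<le> (max B 0)\<^sup>2" for x by (metis abs_ge_zero power2_abs power_mono)
  then have "integrable (lebesgue_on \<Omega>) (\<lambda>x. (\<phi> x)\<^sup>2)"
    using meas
    by (intro finite_measure.integrable_const_bound[where B = "(max B 0)\<^sup>2"]
        finite_measure_lebesgue_on lmeasurable_open assms) auto
  with meas show ?thesis by (simp add: L2_def)
qed

lemma test_functions_differentiable: "\<phi> \<in> test_functions \<Omega> \<Longrightarrow> \<phi> differentiable (at x)"
proof -
  assume "\<phi> \<in> test_functions \<Omega>"
  then have "Ck (Suc 0) \<phi>" unfolding test_functions_def by blast
  then show ?thesis by simp
qed

lemma partial_deriv_lincomb:
  assumes "\<phi> \<in> test_functions \<Omega>" "\<psi> \<in> test_functions \<Omega>"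
  shows "partial_deriv b (\<lambda>x. \<phi> x + c * \<psi> x) x = partial_deriv b \<phi> x + c * partial_deriv b \<psi> x"
  using test_functions_differentiable[OF assms(1), of x] test_functions_differentiable[OF assms(2), of x]
  by (simp add: partial_deriv_add partial_deriv_cmult)

lemma grad_component: "b \<in> Basis \<Longrightarrow> grad \<phi> x \<bullet> b = partial_deriv b \<phi> x"
  by (simp add: grad_def)

lemma grad_lincomb:
  assumes "\<phi> \<in> test_functions \<Omega>" "\<psi> \<in> test_functions \<Omega>"
  shows "grad (\<lambda>x. \<phi> x + c * \<psi> x) x = grad \<phi> x + c *\<^sub>R grad \<psi> x"
  by (simp add: grad_def partial_deriv_lincomb[OF assms] scaleR_add_left sum.distrib scaleR_sum_right)

lemma grad_L2:
  assumes "\<phi> \<in> test_functions \<Omega>" "open \<Omega>" "bounded \<Omega>"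
  shows "grad \<phi> \<in> L2 \<Omega>"
  unfolding grad_def
  by (intro L2_sum L2_scaleR_const test_functions_L2[OF test_functions_partial_deriv] assms)

section \<open>The space H10 and the energy form\<close>

lemma H10_weak_grad:
  assumes "w \<in> H10 \<Omega>"
  shows "is_weak_grad \<Omega> w (weak_grad \<Omega> w)"
proof -
  have "\<exists>g. is_weak_grad \<Omega> w g" using assms unfolding H10_def by blast
  then show ?thesis unfolding weak_grad_def by (rule someI_ex)
qed

lemma H10_zero: "(\<lambda>x. 0) \<in> H10 \<Omega>"
proof -
  have g: "grad (\<lambda>x::'a. 0) = (\<lambda>x. 0)"
    by (simp add: grad_def partial_deriv_def fun_eq_iff)
  have "is_weak_grad \<Omega> (\<lambda>x. 0) (\<lambda>x. 0)" by (simp add: is_weak_grad_def L2_zero)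
  then show ?thesis
    unfolding H10_def mem_Collect_eq
    using L2_zero test_functions_zero
    by (intro conjI exI[of _ "\<lambda>x. 0"] exI[of _ "\<lambda>n x. 0"]) (auto simp: g L2_norm_def L2_inner_def)
qed

lemma is_weak_grad_lincomb:
  assumes \<Omega>: "open \<Omega>" "bounded \<Omega>" and v: "v \<in> L2 \<Omega>" "is_weak_grad \<Omega> v g"
    and w: "w \<in> L2 \<Omega>" "is_weak_grad \<Omega> w h"
  shows "is_weak_grad \<Omega> (\<lambda>x. v x + c * w x) (\<lambda>x. g x + c *\<^sub>R h x)"
  unfolding is_weak_grad_def
proof (intro conjI ballI)
  have gL: "g \<in> L2 \<Omega>" and hL: "h \<in> L2 \<Omega>" using v w by (auto simp: is_weak_grad_def)
  show "(\<lambda>x. g x + c *\<^sub>R h x) \<in> L2 \<Omega>" by (intro L2_add L2_scaleR gL hL)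
  fix \<phi> and b :: 'a assume \<phi>: "\<phi> \<in> test_functions \<Omega>" and b: "b \<in> Basis"
  have \<phi>L: "\<phi> \<in> L2 \<Omega>" and dL: "partial_deriv b \<phi> \<in> L2 \<Omega>"
    using test_functions_L2 test_functions_partial_deriv \<phi> b \<Omega> by blast+
  have i: "integrable (lebesgue_on \<Omega>) (\<lambda>x. u x * partial_deriv b \<phi> x)" if "u \<in> L2 \<Omega>" for u
    using L2_inner_integrable[OF that dL] by simp
  have j: "integrable (lebesgue_on \<Omega>) (\<lambda>x. (G x \<bullet> b) * \<phi> x)" if "G \<in> L2 \<Omega>" for G
    using L2_inner_integrable[OF L2_inner_component[OF that norm_Basis[OF b]] \<phi>L] by simp
  have "(LINT x|lebesgue_on \<Omega>. (v x + c * w x) * partial_deriv b \<phi> x) =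
      (LINT x|lebesgue_on \<Omega>. v x * partial_deriv b \<phi> x) + c * (LINT x|lebesgue_on \<Omega>. w x * partial_deriv b \<phi> x)"
    using i[OF v(1)] i[OF w(1)] by (simp add: ring_distribs mult.assoc)
  also have "\<dots> = - ((LINT x|lebesgue_on \<Omega>. (g x \<bullet> b) * \<phi> x) + c * (LINT x|lebesgue_on \<Omega>. (h x \<bullet> b) * \<phi> x))"
    using v(2) w(2) \<phi> b by (simp add: is_weak_grad_def)
  also have "\<dots> = - (LINT x|lebesgue_on \<Omega>. ((g x + c *\<^sub>R h x) \<bullet> b) * \<phi> x)"
    using j[OF gL] j[OF hL] by (simp add: inner_add_left ring_distribs mult.assoc)
  finally show "(LINT x|lebesgue_on \<Omega>. (v x + c * w x) * partial_deriv b \<phi> x) =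
      - (LINT x|lebesgue_on \<Omega>. ((g x + c *\<^sub>R h x) \<bullet> b) * \<phi> x)" .
qed

lemma H10_lincomb:
  assumes \<Omega>: "open \<Omega>" "bounded \<Omega>" and v: "v \<in> H10 \<Omega>" and w: "w \<in> H10 \<Omega>"
  shows "(\<lambda>x. v x + c * w x) \<in> H10 \<Omega>"
proof -
  obtain g \<phi> where vL: "v \<in> L2 \<Omega>" and g: "is_weak_grad \<Omega> v g"
    and \<phi>: "\<And>n. \<phi> n \<in> test_functions \<Omega>"
    and \<phi>0: "(\<lambda>n. L2_norm \<Omega> (\<lambda>x. \<phi> n x - v x)) \<longlonglongrightarrow> 0"
    and \<phi>1: "(\<lambda>n. L2_norm \<Omega> (\<lambda>x. grad (\<phi> n) x - g x)) \<longlonglongrightarrow> 0"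
    using v unfolding H10_def by blast
  obtain h \<psi> where wL: "w \<in> L2 \<Omega>" and h: "is_weak_grad \<Omega> w h"
    and \<psi>: "\<And>n. \<psi> n \<in> test_functions \<Omega>"
    and \<psi>0: "(\<lambda>n. L2_norm \<Omega> (\<lambda>x. \<psi> n x - w x)) \<longlonglongrightarrow> 0"
    and \<psi>1: "(\<lambda>n. L2_norm \<Omega> (\<lambda>x. grad (\<psi> n) x - h x)) \<longlonglongrightarrow> 0"
    using w unfolding H10_def by blast
  have gL: "g \<in> L2 \<Omega>" and hL: "h \<in> L2 \<Omega>" using g h by (auto simp: is_weak_grad_def)
  let ?\<chi> = "\<lambda>n x. \<phi> n x + c * \<psi> n x"
  have "(\<lambda>n. L2_norm \<Omega> (\<lambda>x. (\<phi> n x - v x) + c *\<^sub>R (\<psi> n x - w x))) \<longlonglongrightarrow> 0"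
    by (intro L2_norm_lincomb_tendsto_0 \<phi>0 \<psi>0 L2_diff vL wL test_functions_L2[OF \<phi> \<Omega>] test_functions_L2[OF \<psi> \<Omega>])
  moreover have "(\<lambda>x. (\<phi> n x - v x) + c *\<^sub>R (\<psi> n x - w x)) = (\<lambda>x. ?\<chi> n x - (v x + c * w x))" for n
    by (simp add: fun_eq_iff algebra_simps)
  ultimately have lim0: "(\<lambda>n. L2_norm \<Omega> (\<lambda>x. ?\<chi> n x - (v x + c * w x))) \<longlonglongrightarrow> 0" by simp
  have "(\<lambda>n. L2_norm \<Omega> (\<lambda>x. (grad (\<phi> n) x - g x) + c *\<^sub>R (grad (\<psi> n) x - h x))) \<longlonglongrightarrow> 0"
    by (intro L2_norm_lincomb_tendsto_0 \<phi>1 \<psi>1 L2_diff gL hL grad_L2[OF \<phi> \<Omega>] grad_L2[OF \<psi> \<Omega>])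
  moreover have "(\<lambda>x. (grad (\<phi> n) x - g x) + c *\<^sub>R (grad (\<psi> n) x - h x)) =
      (\<lambda>x. grad (?\<chi> n) x - (g x + c *\<^sub>R h x))" for n
    by (simp add: fun_eq_iff grad_lincomb[OF \<phi> \<psi>] algebra_simps)
  ultimately have lim1: "(\<lambda>n. L2_norm \<Omega> (\<lambda>x. grad (?\<chi> n) x - (g x + c *\<^sub>R h x))) \<longlonglongrightarrow> 0" by simp
  have vwL: "(\<lambda>x. v x + c * w x) \<in> L2 \<Omega>" by (intro L2_add L2_cmult vL wL)
  show ?thesis
    unfolding H10_def mem_Collect_eq
    using vwL is_weak_grad_lincomb[OF \<Omega> vL g wL h] test_functions_lincomb[OF \<phi> \<psi>] lim0 lim1
    by (intro conjI exI[of _ "\<lambda>x. g x + c *\<^sub>R h x"] exI[of _ ?\<chi>]) auto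
qed

text \<open>Let \<open>\<phi>\<^sub>n\<close> approximate \<open>v\<close>, with \<open>\<nabla>\<phi>\<^sub>n\<close> tending to \<open>g\<close>, and fix a basis vector \<open>b\<close>. The assumption
makes \<open>g \<bullet> b\<close> orthogonal to all test functions, in particular to \<open>\<partial>\<^sub>b\<phi>\<^sub>n\<close>, which tends to \<open>g \<bullet> b\<close>
itself; so \<open>g \<bullet> b = 0\<close> almost everywhere. Next the assumption is applied to the test function
\<open>(x \<bullet> b) \<phi>\<^sub>n\<close>, whose derivative in the direction \<open>b\<close> is \<open>\<phi>\<^sub>n + (x \<bullet> b) \<partial>\<^sub>b\<phi>\<^sub>n\<close>. In the limit,
\<open>(v, v) + (v, (x \<bullet> b) (g \<bullet> b)) = 0\<close>, and the second term is zero.\<close>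

lemma H10_weak_grad_zero:
  assumes \<Omega>: "open \<Omega>" "bounded \<Omega>" and v: "v \<in> H10 \<Omega>"
    and zero: "\<And>\<psi> b. \<psi> \<in> test_functions \<Omega> \<Longrightarrow> b \<in> Basis \<Longrightarrow> L2_inner \<Omega> v (partial_deriv b \<psi>) = 0"
  shows "L2_inner \<Omega> v v = 0"
proof -
  obtain g \<phi> where vL: "v \<in> L2 \<Omega>" and g: "is_weak_grad \<Omega> v g"
    and \<phi>: "\<And>n. \<phi> n \<in> test_functions \<Omega>"
    and lim0: "(\<lambda>n. L2_norm \<Omega> (\<lambda>x. \<phi> n x - v x)) \<longlonglongrightarrow> 0"
    and lim1: "(\<lambda>n. L2_norm \<Omega> (\<lambda>x. grad (\<phi> n) x - g x)) \<longlonglongrightarrow> 0"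
    using v unfolding H10_def by blast
  obtain b :: 'a where b: "b \<in> Basis" using nonempty_Basis by blast
  have gL: "g \<in> L2 \<Omega>" using g by (simp add: is_weak_grad_def)
  have gbL: "(\<lambda>x. g x \<bullet> b) \<in> L2 \<Omega>" using L2_inner_component[OF gL norm_Basis[OF b]] .
  have \<phi>L: "\<phi> n \<in> L2 \<Omega>" for n using test_functions_L2[OF \<phi> \<Omega>] .
  have dL: "partial_deriv c (\<phi> n) \<in> L2 \<Omega>" if "c \<in> Basis" for c n
    using test_functions_L2[OF test_functions_partial_deriv[OF \<phi> that] \<Omega>] .
  have gradL: "grad (\<phi> n) \<in> L2 \<Omega>" for n
    unfolding grad_def by (intro L2_sum L2_scaleR_const dL)
  have d_lim: "(\<lambda>n. L2_inner \<Omega> (partial_deriv b (\<phi> n)) u) \<longlonglongrightarrow> L2_inner \<Omega> (\<lambda>x. g x \<bullet> b) u"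
    if u: "u \<in> L2 \<Omega>" for u :: "'a \<Rightarrow> real"
    using L2_inner_tendsto[OF gradL gL L2_scaleR_const[OF u, of b] lim1]
    by (simp add: L2_inner_def grad_component[OF b] mult.commute)
  have g_test: "L2_inner \<Omega> (\<lambda>x. g x \<bullet> b) \<psi> = 0" if "\<psi> \<in> test_functions \<Omega>" for \<psi>
    using g zero[OF that b] that b by (simp add: is_weak_grad_def L2_inner_def)
  \<comment> \<open>The derivative of an approximant is itself an admissible test function.\<close>
  have "L2_inner \<Omega> (partial_deriv b (\<phi> n)) (\<lambda>x. g x \<bullet> b) = 0" for n
    using g_test[OF test_functions_partial_deriv[OF \<phi> b]] by (simp add: L2_inner_commute)
  with d_lim[OF gbL] have "L2_inner \<Omega> (\<lambda>x. g x \<bullet> b) (\<lambda>x. g x \<bullet> b) = 0"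
    by (simp add: LIMSEQ_const_iff)
  then have gb0: "AE x in lebesgue_on \<Omega>. g x \<bullet> b = 0"
    using L2_inner_self_eq_0_iff[OF gbL] by simp
  obtain B where B: "\<And>x. x \<in> \<Omega> \<Longrightarrow> norm x \<le> B" using \<Omega>(2) by (auto simp: bounded_iff)
  have xvL: "(\<lambda>x. (x \<bullet> b) * v x) \<in> L2 \<Omega>"
  proof (rule L2_mult_bounded[OF vL])
    show "(\<lambda>x. x \<bullet> b) \<in> borel_measurable (lebesgue_on \<Omega>)"
      by (intro measurable_restrict_space1 measurable_completion) simp
    show "\<bar>x \<bullet> b\<bar> \<le> B" if "x \<in> \<Omega>" for x
      using B[OF that] Basis_le_norm[OF b, of x] by simp
    show "\<Omega> \<in> sets lebesgue" using \<Omega> by (simp add: borel_open)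
  qed
  have eq0: "L2_inner \<Omega> (\<phi> n) v + L2_inner \<Omega> (partial_deriv b (\<phi> n)) (\<lambda>x. (x \<bullet> b) * v x) = 0" for n
  proof -
    have "L2_inner \<Omega> v (\<lambda>x. (x \<bullet> b) * partial_deriv b (\<phi> n) x + \<phi> n x) = 0"
    proof -
      have "partial_deriv b (\<lambda>x. (x \<bullet> b) * \<phi> n x) = (\<lambda>x. (x \<bullet> b) * partial_deriv b (\<phi> n) x + \<phi> n x)"
        using b by (intro ext) (simp add: partial_derivI[OF has_derivative_inner_mult[OF test_functions_differentiable[OF \<phi>]]])
      then show ?thesis using zero[OF test_functions_inner_mult[OF \<phi>, of b n] b] by simp
    qed
    moreover have "L2_inner \<Omega> v (\<lambda>x. (x \<bullet> b) * partial_deriv b (\<phi> n) x + \<phi> n x) =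
        L2_inner \<Omega> (\<phi> n) v + L2_inner \<Omega> (partial_deriv b (\<phi> n)) (\<lambda>x. (x \<bullet> b) * v x)"
      using L2_inner_integrable[OF \<phi>L vL, of n] L2_inner_integrable[OF dL[OF b] xvL, of n]
      unfolding L2_inner_def
      by (subst Bochner_Integration.integral_add[symmetric]) (auto simp: algebra_simps)
    ultimately show ?thesis by simp
  qed
  have "(\<lambda>n. L2_inner \<Omega> (\<phi> n) v + L2_inner \<Omega> (partial_deriv b (\<phi> n)) (\<lambda>x. (x \<bullet> b) * v x))
      \<longlonglongrightarrow> L2_inner \<Omega> v v + L2_inner \<Omega> (\<lambda>x. g x \<bullet> b) (\<lambda>x. (x \<bullet> b) * v x)"
    by (intro tendsto_add d_lim xvL L2_inner_tendsto \<phi>L vL lim0)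
  then have "L2_inner \<Omega> v v + L2_inner \<Omega> (\<lambda>x. g x \<bullet> b) (\<lambda>x. (x \<bullet> b) * v x) = 0"
    unfolding eq0 by (simp add: LIMSEQ_const_iff)
  moreover have "L2_inner \<Omega> (\<lambda>x. g x \<bullet> b) (\<lambda>x. (x \<bullet> b) * v x) = 0"
    unfolding L2_inner_def using gb0 by (intro integral_eq_zero_AE) auto
  ultimately show ?thesis by simp
qed

lemma energy_form_commute: "energy_form \<Omega> a v w = energy_form \<Omega> a w v"
  by (simp add: energy_form_def inner_commute)

lemma energy_form_nonneg:
  assumes "\<And>x. x \<in> \<Omega> \<Longrightarrow> 0 \<le> a x"
  shows "0 \<le> energy_form \<Omega> a v v"
  unfolding energy_form_def using assms by (intro Bochner_Integration.integral_nonneg) auto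

text \<open>The coefficient is bounded, so the energy density is integrable and a vanishing integral forces the
weak gradient to vanish almost everywhere.\<close>

lemma energy_form_eq_0_imp:
  assumes \<Omega>: "open \<Omega>" "bounded \<Omega>"
    and a: "a \<in> borel_measurable (lebesgue_on \<Omega>)" "bdd_above (a ` \<Omega>)"
    and pos: "\<And>x. x \<in> \<Omega> \<Longrightarrow> 0 < a x"
    and v: "v \<in> H10 \<Omega>" and e: "energy_form \<Omega> a v v = 0"
  shows "L2_inner \<Omega> v v = 0"
proof (rule H10_weak_grad_zero[OF \<Omega> v])
  define G where "G = weak_grad \<Omega> v"
  have G: "is_weak_grad \<Omega> v G" using H10_weak_grad[OF v] by (simp add: G_def)
  then have GL: "G \<in> L2 \<Omega>" by (simp add: is_weak_grad_def)
  have sp: "space (lebesgue_on \<Omega>) = \<Omega>" by simp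
  obtain B where B: "\<And>x. x \<in> \<Omega> \<Longrightarrow> a x \<le> B" using a(2) by (auto simp: bdd_above_def)
  have "integrable (lebesgue_on \<Omega>) (\<lambda>x. a x * (G x \<bullet> G x))"
  proof (rule Bochner_Integration.integrable_bound)
    show "integrable (lebesgue_on \<Omega>) (\<lambda>x. B * (G x \<bullet> G x))"
      using L2_inner_integrable[OF GL GL] by simp
    show "(\<lambda>x. a x * (G x \<bullet> G x)) \<in> borel_measurable (lebesgue_on \<Omega>)"
      using a(1) L2_dest(1)[OF GL] by simp
    show "AE x in lebesgue_on \<Omega>. norm (a x * (G x \<bullet> G x)) \<le> norm (B * (G x \<bullet> G x))"
    proof (rule AE_I2)
      fix x assume "x \<in> space (lebesgue_on \<Omega>)"
      then have "x \<in> \<Omega>" by simp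
      then show "norm (a x * (G x \<bullet> G x)) \<le> norm (B * (G x \<bullet> G x))"
        using B[of x] pos[of x] by (simp add: abs_mult mult_right_mono)
    qed
  qed
  then have aG: "AE x in lebesgue_on \<Omega>. a x * (G x \<bullet> G x) = 0"
  proof (rule integral_nonneg_eq_0_iff_AE[THEN iffD1])
    show "AE x in lebesgue_on \<Omega>. 0 \<le> a x * (G x \<bullet> G x)"
      using pos by (intro AE_I2) (simp add: less_imp_le)
    show "(LINT x|lebesgue_on \<Omega>. a x * (G x \<bullet> G x)) = 0"
      using e by (simp add: energy_form_def G_def)
  qed
  have G0: "AE x in lebesgue_on \<Omega>. G x = 0"
  proof (rule AE_mp[OF aG AE_I2], rule impI)
    fix x assume "x \<in> space (lebesgue_on \<Omega>)" and "a x * (G x \<bullet> G x) = 0"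
    then show "G x = 0" using pos[of x] by simp
  qed
  fix \<psi> and b :: 'a assume "\<psi> \<in> test_functions \<Omega>" "b \<in> Basis"
  then have "L2_inner \<Omega> v (partial_deriv b \<psi>) = - (LINT x|lebesgue_on \<Omega>. (G x \<bullet> b) * \<psi> x)"
    using G by (simp add: is_weak_grad_def L2_inner_def)
  also have "(LINT x|lebesgue_on \<Omega>. (G x \<bullet> b) * \<psi> x) = 0"
    using G0 by (intro integral_eq_zero_AE) auto
  finally show "L2_inner \<Omega> v (partial_deriv b \<psi>) = 0" by simp
qed

section \<open>Orthogonal projections onto spaces determined by nodal values\<close>

text \<open>Gaussian elimination: one equation is used to eliminate one unknown from the others.\<close>

lemma homogeneous_system_nontrivial_solution:
  fixes M :: "'i \<Rightarrow> 'j \<Rightarrow> real"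
  assumes "finite J" "finite I" "card J < card I"
  shows "\<exists>c. (\<exists>i\<in>I. c i \<noteq> 0) \<and> (\<forall>j\<in>J. (\<Sum>i\<in>I. c i * M i j) = 0)"
  using assms
proof (induction J arbitrary: I M rule: finite_induct)
  case empty
  then have "I \<noteq> {}" by auto
  then show ?case by (intro exI[of _ "\<lambda>_. 1"]) auto
next
  case (insert j J)
  show ?case
  proof (cases "\<forall>i\<in>I. M i j = 0")
    case True
    obtain c where "\<exists>i\<in>I. c i \<noteq> 0" "\<forall>l\<in>J. (\<Sum>i\<in>I. c i * M i l) = 0"
      using insert.IH[of I M] insert.prems insert.hyps by auto
    with True show ?thesis by (intro exI[of _ c]) auto
  next
    case False
    then obtain k where k: "k \<in> I" "M k j \<noteq> 0" by auto
    have split: "sum F I = F k + sum F (I - {k})" for F :: "'i \<Rightarrow> real"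
      using k(1) insert.prems(1) by (rule sum.remove[rotated])
    have "card J < card (I - {k})" using insert k by simp
    then obtain c where c: "\<exists>i\<in>I - {k}. c i \<noteq> 0"
      and c0: "\<forall>l\<in>J. (\<Sum>i\<in>I - {k}. c i * (M i l - M i j / M k j * M k l)) = 0"
      using insert.IH[of "I - {k}" "\<lambda>i l. M i l - M i j / M k j * M k l"] insert.prems(1) by auto
    \<comment> \<open>The value of the eliminated unknown is fixed by equation \<open>j\<close>.\<close>
    define s where "s = (\<Sum>i\<in>I - {k}. c i * M i j) / M k j"
    define c' where "c' = c(k := - s)"
    have c'_sum: "(\<Sum>i\<in>I. c' i * M i l) = (\<Sum>i\<in>I - {k}. c i * M i l) - s * M k l" for l
      unfolding split c'_def by simp
    have "(\<Sum>i\<in>I. c' i * M i l) = 0" if "l \<in> J" for l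
    proof -
      have "0 = (\<Sum>i\<in>I - {k}. c i * M i l - c i * M i j / M k j * M k l)"
        using c0 that by (simp add: algebra_simps)
      also have "\<dots> = (\<Sum>i\<in>I - {k}. c i * M i l) - s * M k l"
        by (simp add: sum_subtractf s_def sum_divide_distrib sum_distrib_right)
      finally show ?thesis by (simp add: c'_sum)
    qed
    moreover have "(\<Sum>i\<in>I. c' i * M i j) = 0" using k by (simp add: c'_sum s_def)
    moreover have "\<exists>i\<in>I. c' i \<noteq> 0" using c by (auto simp: c'_def)
    ultimately show ?thesis by auto
  qed
qed

text \<open>Finite dimension is expressed by a finite set \<open>X\<close> of nodes whose values determine the functions of
the space. Unlike a basis, the nodes are inherited by every subspace, in particular by
eigenspaces.\<close>

locale nodal_space =
  fixes \<Omega> :: "'a::euclidean_space set" and W :: "('a \<Rightarrow> real) set" and X :: "'a set"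
  assumes in_L2: "v \<in> W \<Longrightarrow> v \<in> L2 \<Omega>"
    and zero: "(\<lambda>x. 0) \<in> W"
    and lincomb: "v \<in> W \<Longrightarrow> w \<in> W \<Longrightarrow> (\<lambda>x. v x + c * w x) \<in> W"
    and definite: "v \<in> W \<Longrightarrow> L2_inner \<Omega> v v = 0 \<Longrightarrow> v = (\<lambda>x. 0)"
    and finite_nodes: "finite X"
    and nodes: "v \<in> W \<Longrightarrow> (\<And>x. x \<in> X \<Longrightarrow> v x = 0) \<Longrightarrow> v = (\<lambda>x. 0)"
begin

lemma cmult: "v \<in> W \<Longrightarrow> (\<lambda>x. c * v x) \<in> W"
  using lincomb[OF zero, of v c] by simp

lemma diff: "v \<in> W \<Longrightarrow> w \<in> W \<Longrightarrow> (\<lambda>x. v x - w x) \<in> W"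
  using lincomb[of v w "-1"] by simp

lemma sum_mem: "(\<And>i. i \<in> I \<Longrightarrow> e i \<in> W) \<Longrightarrow> (\<lambda>x. \<Sum>i\<in>I. c i * e i x) \<in> W"
proof (induction I rule: infinite_finite_induct)
  case (insert i I)
  then show ?case using lincomb[of "\<lambda>x. \<Sum>i\<in>I. c i * e i x" "e i" "c i"] by (simp add: add.commute)
qed (simp_all add: zero)

text \<open>With more functions than nodes, some nontrivial linear combination vanishes at all the nodes, hence
identically.\<close>

lemma orthonormal_card_le:
  assumes "finite I" and e: "\<And>i. i \<in> I \<Longrightarrow> e i \<in> W"
    and on: "\<And>i j. i \<in> I \<Longrightarrow> j \<in> I \<Longrightarrow> L2_inner \<Omega> (e i) (e j) = (if i = j then 1 else 0)"
  shows "card I \<le> card X"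
proof (rule ccontr)
  assume "\<not> card I \<le> card X"
  then obtain c where c: "\<exists>i\<in>I. c i \<noteq> 0" and c0: "\<forall>x\<in>X. (\<Sum>i\<in>I. c i * e i x) = 0"
    using homogeneous_system_nontrivial_solution[OF finite_nodes assms(1), of e] by auto
  have s0: "(\<lambda>x. \<Sum>i\<in>I. c i * e i x) = (\<lambda>x. 0)"
    using c0 by (intro nodes sum_mem e) auto
  have "c j = 0" if j: "j \<in> I" for j
  proof -
    have "L2_inner \<Omega> (\<lambda>x. \<Sum>i\<in>I. c i * e i x) (e j) = (\<Sum>i\<in>I. c i * L2_inner \<Omega> (e i) (e j))"
      using e j by (subst L2_inner_sum) (auto simp: L2_inner_cmult in_L2 intro!: L2_cmult)
    also have "\<dots> = (\<Sum>i\<in>I. if i = j then c i else 0)"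
      using on j by (intro sum.cong) auto
    also have "\<dots> = c j" using j assms(1) by simp
    finally show ?thesis by (simp add: s0 L2_inner_zero)
  qed
  with c show False by blast
qed

text \<open>An orthonormal set of maximal cardinality is an orthonormal basis: the normalized remainder of a
function outside its span could be added to it. The projection is then the Fourier sum.\<close>

lemma ex_projection:
  assumes f: "f \<in> L2 \<Omega>"
  shows "\<exists>p\<in>W. \<forall>v\<in>W. L2_inner \<Omega> (\<lambda>x. f x - p x) v = 0"
proof -
  define ON where "ON S \<longleftrightarrow> finite S \<and> S \<subseteq> W \<and>
    (\<forall>u\<in>S. \<forall>v\<in>S. L2_inner \<Omega> u v = (if u = v then 1 else 0))" for S
  have "ON {}" by (simp add: ON_def)
  moreover have "\<forall>S. ON S \<longrightarrow> card S \<le> card X"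
    unfolding ON_def by (intro allI impI orthonormal_card_le[where e = "\<lambda>v. v"]) auto
  ultimately obtain S where S: "ON S" and maxS: "\<And>T. ON T \<Longrightarrow> card T \<le> card S"
    using ex_has_greatest_nat[of ON "{}" card "Suc (card X)"] by (auto simp: less_Suc_eq_le)
  have fin: "finite S" and SW: "\<And>e. e \<in> S \<Longrightarrow> e \<in> W" and SL: "\<And>e. e \<in> S \<Longrightarrow> e \<in> L2 \<Omega>"
    and on: "\<And>u v. u \<in> S \<Longrightarrow> v \<in> S \<Longrightarrow> L2_inner \<Omega> u v = (if u = v then 1 else 0)"
    using S in_L2 unfolding ON_def by auto
  define pr where "pr g = (\<lambda>x. \<Sum>e\<in>S. L2_inner \<Omega> g e * e x)" for g
  have prW: "pr g \<in> W" for g unfolding pr_def by (intro sum_mem SW)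
  have pr_orth: "L2_inner \<Omega> (\<lambda>x. g x - pr g x) e = 0" if g: "g \<in> L2 \<Omega>" and e: "e \<in> S" for g e
  proof -
    have "L2_inner \<Omega> (pr g) e = (\<Sum>u\<in>S. L2_inner \<Omega> g u * L2_inner \<Omega> u e)"
      unfolding pr_def using e SL by (subst L2_inner_sum) (auto simp: L2_inner_cmult intro!: L2_cmult)
    also have "\<dots> = (\<Sum>u\<in>S. if u = e then L2_inner \<Omega> g u else 0)"
      using on e by (intro sum.cong) auto
    also have "\<dots> = L2_inner \<Omega> g e" using e fin by simp
    finally show ?thesis using L2_inner_diff[OF g in_L2[OF prW] SL[OF e]] by simp
  qed
  have expand: "w = pr w" if w: "w \<in> W" for w
  proof (rule ccontr)
    assume ne: "w \<noteq> pr w"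
    define q where "q = (\<lambda>x. w x - pr w x)"
    have qW: "q \<in> W" unfolding q_def by (intro diff w prW)
    have "q \<noteq> (\<lambda>x. 0)" using ne by (auto simp: q_def fun_eq_iff)
    then have n: "L2_norm \<Omega> q \<noteq> 0" using definite[OF qW] by (auto simp: L2_norm_power2[symmetric])
    define u where "u = (\<lambda>x. (1 / L2_norm \<Omega> q) * q x)"
    have uW: "u \<in> W" unfolding u_def by (intro cmult qW)
    have ue: "L2_inner \<Omega> u e = 0" if "e \<in> S" for e
      using pr_orth[OF in_L2[OF w] that] unfolding u_def L2_inner_cmult by (simp add: q_def)
    then have eu: "L2_inner \<Omega> e u = 0" if "e \<in> S" for e
      using that by (simp add: L2_inner_commute)
    have uu: "L2_inner \<Omega> u u = 1" unfolding u_def by (rule L2_inner_normalized[OF n])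
    have "u \<notin> S" using ue[of u] uu by auto
    moreover have "ON (insert u S)"
      unfolding ON_def
    proof (intro conjI ballI)
      show "finite (insert u S)" "insert u S \<subseteq> W" using fin uW SW by auto
      fix y z assume "y \<in> insert u S" "z \<in> insert u S"
      then consider "y = u" "z = u" | "y = u" "z \<in> S" | "y \<in> S" "z = u" | "y \<in> S" "z \<in> S" by blast
      then show "L2_inner \<Omega> y z = (if y = z then 1 else 0)"
        by cases (use uu ue eu on \<open>u \<notin> S\<close> in auto)
    qed
    ultimately show False using maxS[of "insert u S"] fin by simp
  qed
  have "L2_inner \<Omega> (\<lambda>x. f x - pr f x) v = 0" if v: "v \<in> W" for v
  proof -
    have fL: "(\<lambda>x. f x - pr f x) \<in> L2 \<Omega>" by (intro L2_diff f in_L2 prW)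
    have "L2_inner \<Omega> v (\<lambda>x. f x - pr f x) =
        L2_inner \<Omega> (\<lambda>x. \<Sum>e\<in>S. L2_inner \<Omega> v e * e x) (\<lambda>x. f x - pr f x)"
      using expand[OF v] by (simp add: pr_def)
    also have "\<dots> = (\<Sum>e\<in>S. L2_inner \<Omega> v e * L2_inner \<Omega> e (\<lambda>x. f x - pr f x))"
      using SL fL by (subst L2_inner_sum) (auto simp: L2_inner_cmult intro!: L2_cmult)
    also have "\<dots> = 0" using pr_orth[OF f] by (simp add: L2_inner_commute)
    finally show ?thesis by (simp add: L2_inner_commute)
  qed
  with prW show ?thesis by blast
qed

lemma L2_proj:
  assumes f: "f \<in> L2 \<Omega>"
  shows L2_proj_mem: "L2_proj \<Omega> W f \<in> W"
    and L2_proj_orthogonal: "v \<in> W \<Longrightarrow> L2_inner \<Omega> (\<lambda>x. f x - L2_proj \<Omega> W f x) v = 0"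
proof -
  let ?P = "\<lambda>p. p \<in> W \<and> (\<forall>v\<in>W. L2_inner \<Omega> (\<lambda>x. f x - p x) v = 0)"
  have "p = q" if p: "?P p" and q: "?P q" for p q
  proof -
    have d: "(\<lambda>x. p x - q x) \<in> W" using p q by (simp add: diff)
    have "L2_inner \<Omega> (\<lambda>x. f x - q x) (\<lambda>x. p x - q x) - L2_inner \<Omega> (\<lambda>x. f x - p x) (\<lambda>x. p x - q x)
        = L2_inner \<Omega> (\<lambda>x. p x - q x) (\<lambda>x. p x - q x)"
      using in_L2[of p] in_L2[of q] p q f by (subst L2_inner_diff[symmetric]) (auto simp: L2_diff)
    then have "L2_inner \<Omega> (\<lambda>x. p x - q x) (\<lambda>x. p x - q x) = 0" using p q d by simp
    from definite[OF d this] show ?thesis by (simp add: fun_eq_iff)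
  qed
  with ex_projection[OF f] have "\<exists>!p. ?P p" by blast
  from theI'[OF this] have "?P (L2_proj \<Omega> W f)" unfolding L2_proj_def .
  then show "L2_proj \<Omega> W f \<in> W"
    and "v \<in> W \<Longrightarrow> L2_inner \<Omega> (\<lambda>x. f x - L2_proj \<Omega> W f x) v = 0" by auto
qed

lemma inner_L2_proj:
  assumes f: "f \<in> L2 \<Omega>" and v: "v \<in> W"
  shows "L2_inner \<Omega> f v = L2_inner \<Omega> (L2_proj \<Omega> W f) v"
  using L2_proj_orthogonal[OF f v] L2_inner_diff[OF f in_L2[OF L2_proj_mem[OF f]] in_L2[OF v]] by simp

end

section \<open>Spectral calculus of a symmetric operator\<close>

text \<open>Linearity is derived from symmetry (\<open>A_lincomb\<close>): the energy form, evaluated at chosen weak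
gradients, is symmetric by inspection but not visibly additive.\<close>

locale symmetric_operator = nodal_space \<Omega> V X
  for \<Omega> :: "'a::euclidean_space set" and V X +
  fixes A :: "('a \<Rightarrow> real) \<Rightarrow> ('a \<Rightarrow> real)"
  assumes A_mem: "v \<in> V \<Longrightarrow> A v \<in> V"
    and A_sym: "v \<in> V \<Longrightarrow> w \<in> V \<Longrightarrow> L2_inner \<Omega> (A v) w = L2_inner \<Omega> (A w) v"
begin

text \<open>Symmetry moves the operator to the other factor, where the inner product is linear:
\<open>(A(v + c w), \<theta>) = (v + c w, A \<theta>) = (A v + c A w, \<theta>)\<close> for all \<open>\<theta>\<close>.\<close>

lemma A_lincomb:
  assumes v: "v \<in> V" and w: "w \<in> V"
  shows "A (\<lambda>x. v x + c * w x) = (\<lambda>x. A v x + c * A w x)"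
proof -
  have vw: "(\<lambda>x. v x + c * w x) \<in> V" by (intro lincomb v w)
  let ?d = "\<lambda>x. A (\<lambda>x. v x + c * w x) x - (A v x + c * A w x)"
  have inner: "L2_inner \<Omega> (\<lambda>x. g x + c * h x) u = L2_inner \<Omega> g u + c * L2_inner \<Omega> h u"
    if "g \<in> V" "h \<in> V" "u \<in> V" for g h u
    using that L2_inner_add[of g \<Omega> "\<lambda>x. c * h x" u] by (simp add: in_L2 L2_cmult L2_inner_cmult)
  have d: "?d \<in> V" by (intro diff lincomb A_mem vw v w)
  have "L2_inner \<Omega> (A (\<lambda>x. v x + c * w x)) \<theta> = L2_inner \<Omega> (\<lambda>x. A v x + c * A w x) \<theta>"
    if \<theta>: "\<theta> \<in> V" for \<theta>
  proof -
    have "L2_inner \<Omega> (A (\<lambda>x. v x + c * w x)) \<theta> = L2_inner \<Omega> (\<lambda>x. v x + c * w x) (A \<theta>)"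
      using A_sym[OF vw \<theta>] by (simp add: L2_inner_commute)
    also have "\<dots> = L2_inner \<Omega> (A \<theta>) v + c * L2_inner \<Omega> (A \<theta>) w"
      using inner[OF v w A_mem[OF \<theta>]] by (simp add: L2_inner_commute)
    also have "\<dots> = L2_inner \<Omega> (\<lambda>x. A v x + c * A w x) \<theta>"
      using inner[OF A_mem[OF v] A_mem[OF w] \<theta>] A_sym[OF v \<theta>] A_sym[OF w \<theta>] by simp
    finally show ?thesis .
  qed
  from this[OF d] have "L2_inner \<Omega> ?d ?d = 0"
    by (subst L2_inner_diff) (auto intro!: in_L2 d A_mem vw lincomb v w)
  from definite[OF d this] show ?thesis by (simp add: fun_eq_iff)
qed

lemma nodal_space_eigenspace: "nodal_space \<Omega> (eigenspace V A \<mu>) X"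
proof
  have "A (\<lambda>x. 0) = (\<lambda>x. 0)"
    using A_lincomb[OF zero zero, of "-1"] by (simp add: fun_eq_iff)
  then show "(\<lambda>x. 0) \<in> eigenspace V A \<mu>" by (simp add: eigenspace_def zero)
  show "(\<lambda>x. v x + c * w x) \<in> eigenspace V A \<mu>"
    if "v \<in> eigenspace V A \<mu>" "w \<in> eigenspace V A \<mu>" for v w c
    using that by (auto simp: eigenspace_def lincomb A_lincomb algebra_simps)
qed (auto simp: eigenspace_def in_L2 definite finite_nodes nodes)

lemma eigenspace_orthogonal:
  assumes "v \<in> eigenspace V A \<mu>" "w \<in> eigenspace V A \<nu>" "\<mu> \<noteq> \<nu>"
  shows "L2_inner \<Omega> v w = 0"
proof -
  have "\<mu> * L2_inner \<Omega> v w = \<nu> * L2_inner \<Omega> v w"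
    using assms A_sym[of v w] by (simp add: eigenspace_def L2_inner_cmult L2_inner_commute)
  with assms(3) show ?thesis by simp
qed

lemma eigenvector_normalized:
  assumes "\<mu> \<in> eigenvalues V A"
  shows "\<exists>v\<in>eigenspace V A \<mu>. L2_inner \<Omega> v v = 1"
proof -
  interpret E: nodal_space \<Omega> "eigenspace V A \<mu>" X by (rule nodal_space_eigenspace)
  obtain v where v: "v \<in> eigenspace V A \<mu>" "v \<noteq> (\<lambda>x. 0)"
    using assms by (auto simp: eigenvalues_def)
  then have n: "L2_norm \<Omega> v \<noteq> 0" using E.definite by (auto simp: L2_norm_power2[symmetric])
  show ?thesis
  proof (intro bexI)
    show "(\<lambda>x. (1 / L2_norm \<Omega> v) * v x) \<in> eigenspace V A \<mu>" by (intro E.cmult v)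
    show "L2_inner \<Omega> (\<lambda>x. (1 / L2_norm \<Omega> v) * v x) (\<lambda>x. (1 / L2_norm \<Omega> v) * v x) = 1"
      by (rule L2_inner_normalized[OF n])
  qed
qed

text \<open>Unit eigenvectors of distinct eigenvalues form an orthonormal family. Finiteness matters since
\<open>operator_fun\<close> sums over the eigenvalues, and a sum over an infinite set is \<open>0\<close> by convention.\<close>

lemma finite_eigenvalues: "finite (eigenvalues V A)"
proof (rule ccontr)
  assume "infinite (eigenvalues V A)"
  then obtain I where I: "I \<subseteq> eigenvalues V A" "finite I" "card I = Suc (card X)"
    using infinite_arbitrarily_large by blast
  from eigenvector_normalized obtain e where
    e: "\<And>\<mu>. \<mu> \<in> eigenvalues V A \<Longrightarrow> e \<mu> \<in> eigenspace V A \<mu> \<and> L2_inner \<Omega> (e \<mu>) (e \<mu>) = 1"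
    by metis
  have "card I \<le> card X"
  proof (rule orthonormal_card_le[OF I(2), of e])
    show "e \<mu> \<in> V" if "\<mu> \<in> I" for \<mu> using e[of \<mu>] I(1) that by (auto simp: eigenspace_def)
    show "L2_inner \<Omega> (e \<mu>) (e \<nu>) = (if \<mu> = \<nu> then 1 else 0)" if "\<mu> \<in> I" "\<nu> \<in> I" for \<mu> \<nu>
      using e[of \<mu>] e[of \<nu>] I(1) that eigenspace_orthogonal[of "e \<mu>" \<mu> "e \<nu>" \<nu>] by auto
  qed
  with I(3) show False by simp
qed

text \<open>The components \<open>P\<^sub>\<mu> g\<close> are mutually orthogonal, so \<open>\<parallel>F(A) g\<parallel>\<^sup>2 = \<Sum> F(\<mu>)\<^sup>2 \<parallel>P\<^sub>\<mu> g\<parallel>\<^sup>2\<close>, and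
\<open>\<Sum> \<parallel>P\<^sub>\<mu> g\<parallel>\<^sup>2 \<le> \<parallel>g\<parallel>\<^sup>2\<close> by Bessel's inequality.\<close>

lemma operator_fun_norm_le:
  assumes g: "g \<in> L2 \<Omega>" and F: "\<And>\<mu>. \<mu> \<in> eigenvalues V A \<Longrightarrow> \<bar>F \<mu>\<bar> \<le> C" and "0 \<le> C"
  shows "L2_norm \<Omega> (operator_fun \<Omega> V A F g) \<le> C * L2_norm \<Omega> g"
proof -
  let ?\<Lambda> = "eigenvalues V A"
  define P where "P \<mu> = L2_proj \<Omega> (eigenspace V A \<mu>) g" for \<mu>
  have P: "P \<mu> \<in> eigenspace V A \<mu>" for \<mu>
    unfolding P_def by (rule nodal_space.L2_proj_mem[OF nodal_space_eigenspace g])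
  have PL: "P \<mu> \<in> L2 \<Omega>" for \<mu> using P[of \<mu>] in_L2 by (auto simp: eigenspace_def)
  have cPL: "(\<lambda>x. c * P \<mu> x) \<in> L2 \<Omega>" for c \<mu> by (intro L2_cmult PL)
  have gP: "L2_inner \<Omega> g (P \<mu>) = L2_inner \<Omega> (P \<mu>) (P \<mu>)" for \<mu>
    using nodal_space.inner_L2_proj[OF nodal_space_eigenspace g P[of \<mu>]] by (simp add: P_def)
  have orth: "L2_inner \<Omega> (P \<mu>) (P \<nu>) = 0" if "\<mu> \<noteq> \<nu>" for \<mu> \<nu>
    using eigenspace_orthogonal[OF P P that] .
  have pyth: "L2_inner \<Omega> (\<lambda>x. \<Sum>\<mu>\<in>?\<Lambda>. c \<mu> * P \<mu> x) (\<lambda>x. \<Sum>\<mu>\<in>?\<Lambda>. c \<mu> * P \<mu> x)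
      = (\<Sum>\<mu>\<in>?\<Lambda>. (c \<mu>)\<^sup>2 * L2_inner \<Omega> (P \<mu>) (P \<mu>))" for c
  proof -
    have "L2_inner \<Omega> (P \<mu>) (\<lambda>x. \<Sum>\<nu>\<in>?\<Lambda>. c \<nu> * P \<nu> x) = c \<mu> * L2_inner \<Omega> (P \<mu>) (P \<mu>)"
      if "\<mu> \<in> ?\<Lambda>" for \<mu>
    proof -
      have "L2_inner \<Omega> (\<lambda>x. \<Sum>\<nu>\<in>?\<Lambda>. c \<nu> * P \<nu> x) (P \<mu>) = (\<Sum>\<nu>\<in>?\<Lambda>. c \<nu> * L2_inner \<Omega> (P \<nu>) (P \<mu>))"
        by (subst L2_inner_sum) (auto simp: L2_inner_cmult cPL PL)
      also have "\<dots> = (\<Sum>\<nu>\<in>?\<Lambda>. if \<nu> = \<mu> then c \<mu> * L2_inner \<Omega> (P \<mu>) (P \<mu>) else 0)"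
        by (intro sum.cong) (auto simp: orth)
      also have "\<dots> = c \<mu> * L2_inner \<Omega> (P \<mu>) (P \<mu>)"
        using that finite_eigenvalues by simp
      finally show ?thesis by (simp add: L2_inner_commute)
    qed
    moreover have "L2_inner \<Omega> (\<lambda>x. \<Sum>\<mu>\<in>?\<Lambda>. c \<mu> * P \<mu> x) (\<lambda>x. \<Sum>\<mu>\<in>?\<Lambda>. c \<mu> * P \<mu> x)
        = (\<Sum>\<mu>\<in>?\<Lambda>. c \<mu> * L2_inner \<Omega> (P \<mu>) (\<lambda>x. \<Sum>\<mu>\<in>?\<Lambda>. c \<mu> * P \<mu> x))"
      by (subst L2_inner_sum) (auto simp: L2_inner_cmult cPL intro!: L2_sum)
    ultimately show ?thesis by (simp add: power2_eq_square mult.assoc)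
  qed
  have bessel: "(\<Sum>\<mu>\<in>?\<Lambda>. L2_inner \<Omega> (P \<mu>) (P \<mu>)) \<le> L2_inner \<Omega> g g"
  proof -
    let ?S = "\<lambda>x. \<Sum>\<mu>\<in>?\<Lambda>. 1 * P \<mu> x"
    have SL: "?S \<in> L2 \<Omega>" by (intro L2_sum cPL)
    have "L2_inner \<Omega> ?S g = (\<Sum>\<mu>\<in>?\<Lambda>. L2_inner \<Omega> (P \<mu>) (P \<mu>))"
      using gP by (subst L2_inner_sum) (auto simp: PL g L2_inner_commute)
    moreover have "L2_inner \<Omega> ?S ?S = (\<Sum>\<mu>\<in>?\<Lambda>. L2_inner \<Omega> (P \<mu>) (P \<mu>))"
      using pyth[of "\<lambda>_. 1"] by simp
    moreover have "0 \<le> L2_inner \<Omega> ?S ?S * (-1)\<^sup>2 + (2 * L2_inner \<Omega> g ?S) * (-1) + L2_inner \<Omega> g g"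
      unfolding L2_inner_quadratic[OF g SL, symmetric] by (rule L2_inner_nonneg)
    ultimately show ?thesis by (simp add: L2_inner_commute)
  qed
  have "(L2_norm \<Omega> (operator_fun \<Omega> V A F g))\<^sup>2 = (\<Sum>\<mu>\<in>?\<Lambda>. (F \<mu>)\<^sup>2 * L2_inner \<Omega> (P \<mu>) (P \<mu>))"
    unfolding L2_norm_power2 operator_fun_def P_def[symmetric] by (rule pyth)
  also have "\<dots> \<le> (\<Sum>\<mu>\<in>?\<Lambda>. C\<^sup>2 * L2_inner \<Omega> (P \<mu>) (P \<mu>))"
  proof (intro sum_mono mult_right_mono L2_inner_nonneg)
    show "(F \<mu>)\<^sup>2 \<le> C\<^sup>2" if "\<mu> \<in> ?\<Lambda>" for \<mu>
      using F[OF that] by (metis abs_ge_zero power2_abs power_mono)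
  qed
  also have "\<dots> \<le> (C * L2_norm \<Omega> g)\<^sup>2"
    using bessel by (simp add: sum_distrib_left[symmetric] power_mult_distrib L2_norm_power2 mult_left_mono)
  finally show ?thesis
    by (rule power2_le_imp_le) (simp add: assms(3) L2_norm_nonneg)
qed

end

section \<open>The finite element space\<close>

text \<open>The set where a continuous function is negative is open, and a nonempty open set is not a null set.\<close>

lemma nonneg_if_AE_nonneg:
  fixes f :: "'a::euclidean_space \<Rightarrow> real"
  assumes S: "open S" and f: "continuous_on S f" and ae: "AE x in lebesgue. x \<in> S \<longrightarrow> 0 \<le> f x"
    and x: "x \<in> S"
  shows "0 \<le> f x"
proof (rule ccontr)
  assume "\<not> 0 \<le> f x"
  let ?N = "{y \<in> S. f y < 0}"
  have "open (f -` {..<0} \<inter> S)" using f S by (intro continuous_on_open_vimage[THEN iffD1, rule_format]) auto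
  moreover have "f -` {..<0} \<inter> S = ?N" by auto
  ultimately have "open ?N" by simp
  moreover have "?N \<noteq> {}" using x \<open>\<not> 0 \<le> f x\<close> by auto
  moreover have "negligible ?N"
  proof -
    have "AE y in lebesgue. y \<notin> ?N" using ae by eventually_elim auto
    moreover have "?N \<in> sets lebesgue" using \<open>open ?N\<close> by (simp add: borel_open)
    ultimately have "?N \<in> null_sets lebesgue" by (simp add: AE_iff_null_sets)
    then show ?thesis by (simp add: negligible_iff_null_sets)
  qed
  ultimately show False using open_not_negligible by blast
qed

lemma continuous_L2_eq_0:
  fixes v :: "'a::euclidean_space \<Rightarrow> real"
  assumes "open S" "continuous_on S v" "v \<in> L2 S" "L2_inner S v v = 0" "x \<in> S"
  shows "v x = 0"
proof -
  have "AE x in lebesgue_on S. v x = 0"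
    using assms by (simp add: L2_inner_self_eq_0_iff)
  then have "AE x in lebesgue. x \<in> S \<longrightarrow> v x = 0"
    using assms(1) by (simp add: AE_restrict_space_iff borel_open)
  then have "AE x in lebesgue. x \<in> S \<longrightarrow> 0 \<le> - \<bar>v x\<bar>" by eventually_elim simp
  then have "0 \<le> - \<bar>v x\<bar>"
    by (rule nonneg_if_AE_nonneg[OF assms(1) _ _ assms(5), rotated]) (intro continuous_intros assms(2))
  then show ?thesis by simp
qed

lemma fe_space_affine: "v \<in> fe_space \<Omega> \<T> \<Longrightarrow> K \<in> \<T> \<Longrightarrow> \<exists>p c. \<forall>x\<in>K. v x = p \<bullet> x + c"
  by (simp add: fe_space_def)

text \<open>The nodes are the vertices of the simplices: an affine function that is zero at the vertices is zero
on their convex hull.\<close>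

lemma fe_space_nodal:
  assumes \<Omega>: "open \<Omega>" "bounded \<Omega>" and T: "quasi_uniform_partition \<sigma> \<Omega> \<T>"
  shows "\<exists>X. nodal_space \<Omega> (fe_space \<Omega> \<T>) X"
proof -
  have fin: "finite \<T>" and cover: "\<Union>\<T> = closure \<Omega>"
    using T by (simp_all add: quasi_uniform_partition_def triangulation_def)
  have "\<exists>C. finite C \<and> K = convex hull C" if "K \<in> \<T>" for K
  proof -
    have "int DIM('a) simplex K" using T that by (simp add: quasi_uniform_partition_def)
    then show ?thesis unfolding simplex by blast
  qed
  then obtain C where Cfin: "\<And>K. K \<in> \<T> \<Longrightarrow> finite (C K)"
    and hull: "\<And>K. K \<in> \<T> \<Longrightarrow> convex hull C K = K" by metis
  have "nodal_space \<Omega> (fe_space \<Omega> \<T>) (\<Union>K\<in>\<T>. C K)"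
  proof
    show inL2: "v \<in> L2 \<Omega>" if "v \<in> fe_space \<Omega> \<T>" for v
      using that by (simp add: fe_space_def H10_def)
    show "(\<lambda>x. 0) \<in> fe_space \<Omega> \<T>"
    proof -
      have "\<forall>K\<in>\<T>. \<exists>p c. \<forall>x\<in>K. 0 = p \<bullet> x + c"
        by (intro ballI exI[of _ 0]) simp
      then show ?thesis by (simp add: fe_space_def H10_zero)
    qed
    show "finite (\<Union>K\<in>\<T>. C K)" using fin Cfin by simp
    show "(\<lambda>x. v x + c * w x) \<in> fe_space \<Omega> \<T>" if v: "v \<in> fe_space \<Omega> \<T>" and w: "w \<in> fe_space \<Omega> \<T>" for v w c
    proof -
      have "\<exists>p d. \<forall>x\<in>K. v x + c * w x = p \<bullet> x + d" if K: "K \<in> \<T>" for K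
      proof -
        obtain p d where "\<forall>x\<in>K. v x = p \<bullet> x + d" using fe_space_affine[OF v K] by blast
        moreover obtain q e where "\<forall>x\<in>K. w x = q \<bullet> x + e" using fe_space_affine[OF w K] by blast
        ultimately show ?thesis
          by (intro exI[of _ "p + c *\<^sub>R q"] exI[of _ "d + c * e"]) (simp add: inner_add_left algebra_simps)
      qed
      then show ?thesis
        using v w H10_lincomb[OF \<Omega>, of v w c]
        by (simp add: fe_space_def continuous_on_add continuous_on_mult)
    qed
    show "v = (\<lambda>x. 0)" if v: "v \<in> fe_space \<Omega> \<T>" and 0: "L2_inner \<Omega> v v = 0" for v
    proof
      fix x
      have "continuous_on \<Omega> v"
        using v closure_subset[of \<Omega>] by (auto simp: fe_space_def intro: continuous_on_subset)
      then show "v x = 0"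
        using continuous_L2_eq_0[OF \<Omega>(1) _ inL2[OF v] 0, of x] v by (cases "x \<in> \<Omega>") (auto simp: fe_space_def)
    qed
    show "v = (\<lambda>x. 0)" if v: "v \<in> fe_space \<Omega> \<T>" and 0: "\<And>x. x \<in> (\<Union>K\<in>\<T>. C K) \<Longrightarrow> v x = 0" for v
    proof
      fix x
      show "v x = 0"
      proof (cases "x \<in> \<Omega>")
        case True
        then obtain K where K: "K \<in> \<T>" "x \<in> K" using cover closure_subset[of \<Omega>] by blast
        obtain p d where pd: "\<And>x. x \<in> K \<Longrightarrow> v x = p \<bullet> x + d"
          using fe_space_affine[OF v K(1)] by blast
        have "C K \<subseteq> {x. p \<bullet> x = - d}"
        proof
          fix y assume y: "y \<in> C K"
          then have "y \<in> K" using hull[OF K(1)] hull_subset[of "C K" convex] by blast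
          moreover have "v y = 0" using y K(1) by (intro 0) blast
          ultimately show "y \<in> {x. p \<bullet> x = - d}" using pd[of y] by simp
        qed
        then have "convex hull C K \<subseteq> {x. p \<bullet> x = - d}" by (rule hull_minimal) (rule convex_hyperplane)
        then show ?thesis using pd[OF K(2)] K hull[OF K(1)] by auto
      qed (use v in \<open>simp add: fe_space_def\<close>)
    qed
  qed
  then show ?thesis ..
qed

text \<open>Strict positivity is essential for what follows: it places \<open>\<lambda>\<^sub>1 / \<mu>\<close> in \<open>[0,1]\<close>, and it excludes the
convention \<open>0 powr x = 0\<close>.\<close>

lemma discrete_operator_eigenvalue_pos:
  assumes \<Omega>: "open \<Omega>" "bounded \<Omega>"
    and a: "a \<in> borel_measurable (lebesgue_on \<Omega>)" "bdd_above (a ` \<Omega>)"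
    and pos: "\<And>x. x \<in> \<Omega> \<Longrightarrow> 0 < a x"
    and V: "nodal_space \<Omega> V X" "V \<subseteq> H10 \<Omega>"
    and A: "is_discrete_operator \<Omega> a V A" and \<mu>: "\<mu> \<in> eigenvalues V A"
  shows "0 < \<mu>"
proof -
  interpret nodal_space \<Omega> V X by (rule V)
  obtain v where v: "v \<in> V" "A v = (\<lambda>x. \<mu> * v x)" "v \<noteq> (\<lambda>x. 0)"
    using \<mu> unfolding eigenvalues_def eigenspace_def by blast
  then have ne: "L2_inner \<Omega> v v \<noteq> 0" using definite by blast
  have eq: "\<mu> * L2_inner \<Omega> v v = energy_form \<Omega> a v v"
  proof -
    have "energy_form \<Omega> a v v = L2_inner \<Omega> (A v) v"
      using A v(1) by (simp add: is_discrete_operator_def)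
    then show ?thesis unfolding v(2) L2_inner_cmult by simp
  qed
  moreover have "energy_form \<Omega> a v v \<noteq> 0"
    using energy_form_eq_0_imp[OF \<Omega> a pos, of v] ne v(1) V(2) by blast
  moreover have "0 \<le> energy_form \<Omega> a v v"
    using pos by (intro energy_form_nonneg) (simp add: less_imp_le)
  ultimately have "0 < \<mu> * L2_inner \<Omega> v v" by simp
  then show ?thesis using L2_inner_nonneg[of \<Omega> v] by (simp add: zero_less_mult_iff)
qed

section \<open>Pointwise error of the best rational approximation\<close>

lemma AE_lebesgue_unit_interval:
  fixes Pr :: "real \<Rightarrow> bool"
  shows "(AE t in lebesgue_on {0..1}. Pr t) \<longleftrightarrow> (AE t in lebesgue. t \<in> {0..1} \<longrightarrow> Pr t)"
  by (simp add: AE_restrict_space_iff)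

text \<open>The zero function competes and has error at most \<open>1\<close>.\<close>

lemma best_approx_error_finite:
  assumes "is_best_rational_approx \<alpha> k r" "0 \<le> \<alpha>"
  shows "\<exists>E\<ge>0. approx_error \<alpha> r = ereal E"
proof -
  have "(\<lambda>t. 0) \<in> rational_functions k"
    unfolding rational_functions_def mem_Collect_eq
    by (rule exI[of _ 0], rule exI[of _ 1]) simp
  then have "approx_error \<alpha> r \<le> approx_error \<alpha> (\<lambda>t. 0)"
    using assms(1) unfolding is_best_rational_approx_def by blast
  also have "\<dots> \<le> ereal 1"
    unfolding approx_error_def
  proof (rule esssup_I)
    show "(\<lambda>t. ereal \<bar>0 - t powr \<alpha>\<bar>) \<in> borel_measurable (lebesgue_on {0..1})"
      by (intro measurable_restrict_space1 measurable_completion) simp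
    show "AE t in lebesgue_on {0..1}. ereal \<bar>0 - t powr \<alpha>\<bar> \<le> ereal 1"
      using assms(2) by (intro AE_I2) (simp add: powr_le1)
  qed
  finally have le: "approx_error \<alpha> r \<le> ereal 1" .
  \<comment> \<open>The essential supremum of a nonnegative function is negative only over a null set; were it
      negative here, \<open>0 \<le> -1\<close> would hold almost everywhere on the open unit interval.\<close>
  have "0 \<le> approx_error \<alpha> r"
  proof (rule ccontr)
    assume neg: "\<not> 0 \<le> approx_error \<alpha> r"
    have "AE t in lebesgue_on {0..1}. ereal \<bar>r t - t powr \<alpha>\<bar> \<le> approx_error \<alpha> r"
      unfolding approx_error_def by (rule esssup_AE)
    then have "AE t in lebesgue_on {0..1::real}. False"
    proof eventually_elim
      case (elim t)
      have "0 \<le> ereal \<bar>r t - t powr \<alpha>\<bar>" by simp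
      with elim neg show False by (metis order_trans)
    qed
    then have "AE t in lebesgue. t \<in> {0<..<1::real} \<longrightarrow> 0 \<le> (-1::real)"
      unfolding AE_lebesgue_unit_interval by eventually_elim auto
    from nonneg_if_AE_nonneg[OF _ _ this, of "1/2"] show False by simp
  qed
  with le show ?thesis by (cases "approx_error \<alpha> r") auto
qed

text \<open>Off the zeros of \<open>Q\<close>, the almost everywhere bound says that
\<open>h(t) = E \<bar>Q(t)\<bar> - \<bar>P(t) - t\<^sup>\<alpha> Q(t)\<bar>\<close> is nonnegative. As \<open>h\<close> is continuous, it is nonnegative on all
of \<open>[0,1]\<close>. A zero of \<open>Q\<close> in \<open>[0,1]\<close> would thus be a zero of \<open>P\<close>, contrary to coprimality, and
division by \<open>\<bar>Q(t)\<bar>\<close> is possible everywhere.\<close>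

lemma best_approx_pointwise:
  assumes best: "is_best_rational_approx \<alpha> k r" and \<alpha>: "0 < \<alpha>" and t: "t \<in> {0..1}"
  shows "\<bar>r t - t powr \<alpha>\<bar> \<le> real_of_ereal (approx_error \<alpha> r)"
proof -
  obtain E where E: "0 \<le> E" "approx_error \<alpha> r = ereal E"
    using best_approx_error_finite[OF best] \<alpha> by auto
  obtain P Q where r: "r = (\<lambda>t. poly P t / poly Q t)" and Q0: "poly Q 0 = 1" and PQ: "coprime P Q"
    using best unfolding is_best_rational_approx_def rational_functions_def by auto
  define h where "h t = E * \<bar>poly Q t\<bar> - \<bar>poly P t - t powr \<alpha> * poly Q t\<bar>" for t
  have h_cont: "continuous_on {0..1} h"
    unfolding h_def using \<alpha> by (intro continuous_intros continuous_on_powr') auto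
  have h_mult: "h t = (E - \<bar>r t - t powr \<alpha>\<bar>) * \<bar>poly Q t\<bar>" if "poly Q t \<noteq> 0" for t
  proof -
    have "poly P t - t powr \<alpha> * poly Q t = (r t - t powr \<alpha>) * poly Q t"
      using that by (simp add: r field_simps)
    then show ?thesis by (simp only: h_def abs_mult left_diff_distrib[of E])
  qed
  have "finite {t. poly Q t = 0}" using Q0 by (intro poly_roots_finite) auto
  then have "AE t in lebesgue. t \<notin> {t. poly Q t = 0}"
    by (intro AE_not_in) (simp add: negligible_iff_null_sets[symmetric] negligible_finite)
  moreover have "AE t in lebesgue. t \<in> {0..1} \<longrightarrow> ereal \<bar>r t - t powr \<alpha>\<bar> \<le> approx_error \<alpha> r"
    unfolding AE_lebesgue_unit_interval[symmetric] approx_error_def by (rule esssup_AE)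
  ultimately have "AE t in lebesgue. t \<in> {0<..<1} \<longrightarrow> 0 \<le> h t"
    by eventually_elim (auto simp: h_mult E)
  then have "0 \<le> h s" if "s \<in> {0<..<1}" for s
    using that by (intro nonneg_if_AE_nonneg[of "{0<..<1}" h] continuous_on_subset[OF h_cont]) auto
  moreover have "closure {0<..<1} = {0..1::real}" by (rule closure_greaterThanLessThan) simp
  ultimately have h0: "0 \<le> h t"
    using continuous_ge_on_closure[of "{0<..<1}" h t 0] h_cont t by metis
  have "poly Q t \<noteq> 0"
  proof
    assume Qt: "poly Q t = 0"
    with h0 have "poly P t = 0" by (simp add: h_def)
    with Qt have "[:- t, 1:] dvd P" "[:- t, 1:] dvd Q" by (simp_all add: poly_eq_0_iff_dvd)
    with PQ have "[:- t, 1:] dvd 1" by (meson coprime_common_divisor is_unit_poly_iff)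
    then show False by (simp add: is_unit_poly_iff)
  qed
  with h0 h_mult[of t] show ?thesis by (simp add: E zero_le_mult_iff)
qed

section \<open>The error of the fully discrete approximation\<close>

theorem mainTheorem3:
  fixes \<Omega> :: "'a::euclidean_space set" and \<T> :: "'a set set"
    and a f f_h u_h w_h :: "'a \<Rightarrow> real" and V_h :: "('a \<Rightarrow> real) set"
    and A :: "('a \<Rightarrow> real) \<Rightarrow> ('a \<Rightarrow> real)" and r :: "real \<Rightarrow> real"
    and a\<^sub>0 \<sigma> \<alpha> lambda\<^sub>1 E :: real and k :: nat
  assumes "open \<Omega>" and "connected \<Omega>" and "\<Omega> \<noteq> {}" and "bounded \<Omega>"
    and "a \<in> borel_measurable (lebesgue_on \<Omega>)" and "bdd_above (a ` \<Omega>)"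
    and "0 < a\<^sub>0" and "\<forall>x\<in>\<Omega>. a\<^sub>0 \<le> a x"
    and "0 < \<sigma>" and "quasi_uniform_partition \<sigma> \<Omega> \<T>"
    and "V_h = fe_space \<Omega> \<T>"
    and "is_discrete_operator \<Omega> a V_h A"
    and "lambda\<^sub>1 = smallest_eigenvalue V_h A"
    and "0 < \<alpha>" and "\<alpha> < 1" and "1 \<le> k"
    and "is_best_rational_approx \<alpha> k r"
    and "E = real_of_ereal (approx_error \<alpha> r)"
    and "f \<in> L2 \<Omega>" and "f_h = L2_proj \<Omega> V_h f"
    and "u_h = operator_fun \<Omega> V_h A (\<lambda>\<mu>. \<mu> powr (- \<alpha>)) f_h"
    and "w_h = (\<lambda>x. lambda\<^sub>1 powr (- \<alpha>) * operator_fun \<Omega> V_h A (\<lambda>\<mu>. r (lambda\<^sub>1 * inverse \<mu>)) f_h x)"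
  shows "L2_norm \<Omega> (\<lambda>x. u_h x - w_h x) \<le> lambda\<^sub>1 powr (- \<alpha>) * E * L2_norm \<Omega> f_h"
proof -
  note \<Omega> = \<open>open \<Omega>\<close> \<open>bounded \<Omega>\<close>
  note approx = best_approx_pointwise[OF \<open>is_best_rational_approx \<alpha> k r\<close> \<open>0 < \<alpha>\<close>,
      folded \<open>E = real_of_ereal (approx_error \<alpha> r)\<close>]
  have a_pos: "\<And>x. x \<in> \<Omega> \<Longrightarrow> 0 < a x" using \<open>0 < a\<^sub>0\<close> \<open>\<forall>x\<in>\<Omega>. a\<^sub>0 \<le> a x\<close> by fastforce
  obtain X where X: "nodal_space \<Omega> V_h X"
    using fe_space_nodal[OF \<Omega> \<open>quasi_uniform_partition \<sigma> \<Omega> \<T>\<close>] \<open>V_h = fe_space \<Omega> \<T>\<close> by auto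
  interpret nodal_space \<Omega> V_h X by (rule X)
  interpret symmetric_operator \<Omega> V_h X A
    using \<open>is_discrete_operator \<Omega> a V_h A\<close>
    by unfold_locales (auto simp: is_discrete_operator_def energy_form_commute)
  have f_h: "f_h \<in> L2 \<Omega>"
    using L2_proj_mem[OF \<open>f \<in> L2 \<Omega>\<close>] by (simp add: \<open>f_h = L2_proj \<Omega> V_h f\<close> in_L2)
  have E: "0 \<le> E" using approx[of 0] by simp
  define F where "F \<mu> = \<mu> powr (- \<alpha>) - lambda\<^sub>1 powr (- \<alpha>) * r (lambda\<^sub>1 * inverse \<mu>)" for \<mu>
  have "\<bar>F \<mu>\<bar> \<le> lambda\<^sub>1 powr (- \<alpha>) * E" if \<mu>: "\<mu> \<in> eigenvalues V_h A" for \<mu>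
  proof -
    have pos: "0 < \<nu>" if "\<nu> \<in> eigenvalues V_h A" for \<nu>
      using discrete_operator_eigenvalue_pos[OF \<Omega> assms(5,6) a_pos X _ assms(12) that] assms(11)
      by (auto simp: fe_space_def)
    have "lambda\<^sub>1 \<in> eigenvalues V_h A" "lambda\<^sub>1 \<le> \<mu>"
      using \<mu> finite_eigenvalues by (auto simp: assms(13) smallest_eigenvalue_def intro!: Min_in)
    then have l: "0 < lambda\<^sub>1" "lambda\<^sub>1 \<le> \<mu>" and m: "0 < \<mu>" using pos \<mu> by auto
    let ?t = "lambda\<^sub>1 * inverse \<mu>"
    have "lambda\<^sub>1 powr (- \<alpha>) * ?t powr \<alpha> = \<mu> powr (- \<alpha>)"
    proof -
      have "?t powr \<alpha> = lambda\<^sub>1 powr \<alpha> * \<mu> powr (- \<alpha>)"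
        using l m by (simp add: powr_mult inverse_powr powr_minus)
      moreover have "lambda\<^sub>1 powr (- \<alpha>) * lambda\<^sub>1 powr \<alpha> = 1"
        using l by (simp add: powr_minus)
      ultimately show ?thesis by (simp add: mult.assoc[symmetric])
    qed
    then have "F \<mu> = lambda\<^sub>1 powr (- \<alpha>) * (?t powr \<alpha> - r ?t)"
      by (simp add: F_def right_diff_distrib)
    moreover have "\<bar>?t powr \<alpha> - r ?t\<bar> \<le> E"
      using approx[of ?t] l m by (simp add: field_simps abs_minus_commute)
    ultimately show ?thesis by (simp add: abs_mult mult_left_mono)
  qed
  then have "L2_norm \<Omega> (operator_fun \<Omega> V_h A F f_h) \<le> lambda\<^sub>1 powr (- \<alpha>) * E * L2_norm \<Omega> f_h"
    using E f_h by (intro operator_fun_norm_le) auto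
  moreover have "(\<lambda>x. u_h x - w_h x) = operator_fun \<Omega> V_h A F f_h"
    by (simp add: assms(21,22) operator_fun_def F_def fun_eq_iff sum_subtractf[symmetric]
        sum_distrib_left left_diff_distrib mult.assoc)
  ultimately show ?thesis by simp
qed

end
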